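(* Let $G$ be a polycyclic group and suppose that every finite quotient of $G$ is a UT-group. Then $G$ is a UT-group.
   Context: For a group $G$, $\mathcal{U}_1(\mathbb{Z}G)$ denotes the group of units of augmentation one of the integral group ring $\mathbb{Z}G$. For $\alpha=\sum_{h\in G}\alpha(h)h\in\mathbb{Z}G$ and $g\in G$, let $C_g$ be the conjugacy class of $g$ in $G$ and set $\tilde{\alpha}(g)=\sum_{h\in C_g}\alpha(h)$. A unit $\alpha\in\mathcal{U}_1(\mathbb{Z}G)$ has the unique trace property if there exists an element $g\in G$, unique up to conjugacy in $G$, such that $\tilde{\alpha}(g)\neq 0$. A group $G$ is a UT-group (has the UT-property) if every element of finite order of $\mathcal{U}_1(\mathbb{Z}G)$ has the unique trace property. *)

theory Defs
  imports "HOL-Algebra.Elementary_Groups" "HOL-Algebra.Ring" "HOL-Library.Poly_Mapping"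
begin

text \<open>
  Elements of the group ring are finitely supported functions into the integers
  with support in the carrier of \<open>G\<close>; \<^term>\<open>frag_of g\<close> is the group element
  \<open>g\<close> seen in the group ring, and the product is the bilinear extension of the product of \<open>G\<close>:
  the sum over \<open>g\<close>, \<open>h\<close> of \<open>\<alpha>(g) \<beta>(h) gh\<close>.
\<close>

definition integral_group_ring :: "('a, 'b) monoid_scheme \<Rightarrow> ('a \<Rightarrow>\<^sub>0 int) ring" where
  "integral_group_ring G =
     \<lparr>carrier = {\<alpha>. Poly_Mapping.keys \<alpha> \<subseteq> carrier G},
      mult = (\<lambda>\<alpha> \<beta>. frag_extend (\<lambda>g. frag_extend (\<lambda>h. frag_of (g \<otimes>\<^bsub>G\<^esub> h)) \<beta>) \<alpha>),
      one = frag_of \<one>\<^bsub>G\<^esub>,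
      zero = 0,
      add = (+)\<rparr>"

definition augmentation :: "('a \<Rightarrow>\<^sub>0 int) \<Rightarrow> int" where
  "augmentation \<alpha> = (\<Sum>g\<in>Poly_Mapping.keys \<alpha>. Poly_Mapping.lookup \<alpha> g)"

definition normalized_unit_group :: "('a, 'b) monoid_scheme \<Rightarrow> ('a \<Rightarrow>\<^sub>0 int) monoid" where
  "normalized_unit_group G =
     (units_of (integral_group_ring G))
       \<lparr>carrier := {\<alpha> \<in> Units (integral_group_ring G). augmentation \<alpha> = 1}\<rparr>"

definition conjugacy_class :: "('a, 'b) monoid_scheme \<Rightarrow> 'a \<Rightarrow> 'a set" where
  "conjugacy_class G g = {x \<otimes>\<^bsub>G\<^esub> g \<otimes>\<^bsub>G\<^esub> inv\<^bsub>G\<^esub> x | x. x \<in> carrier G}"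

text \<open>
  A conjugacy class of an infinite group may be infinite, and \<^const>\<open>sum\<close> over an infinite
  set is 0 by convention, so the sum is restricted to the (finite) support of \<open>\<alpha>\<close>.
\<close>

definition partial_trace ::
    "('a, 'b) monoid_scheme \<Rightarrow> ('a \<Rightarrow>\<^sub>0 int) \<Rightarrow> 'a \<Rightarrow> int" where
  "partial_trace G \<alpha> g =
     (\<Sum>h \<in> conjugacy_class G g \<inter> Poly_Mapping.keys \<alpha>. Poly_Mapping.lookup \<alpha> h)"

definition unique_trace :: "('a, 'b) monoid_scheme \<Rightarrow> ('a \<Rightarrow>\<^sub>0 int) \<Rightarrow> bool" where
  "unique_trace G \<alpha> \<longleftrightarrow>
     (\<exists>g\<in>carrier G. partial_trace G \<alpha> g \<noteq> 0 \<and>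
        (\<forall>h\<in>carrier G. partial_trace G \<alpha> h \<noteq> 0 \<longrightarrow> h \<in> conjugacy_class G g))"

definition UT_group :: "('a, 'b) monoid_scheme \<Rightarrow> bool" where
  "UT_group G \<longleftrightarrow>
     (\<forall>\<alpha>\<in>carrier (normalized_unit_group G).
        (\<exists>n::nat. n > 0 \<and> \<alpha> [^]\<^bsub>normalized_unit_group G\<^esub> n = \<one>\<^bsub>normalized_unit_group G\<^esub>)
          \<longrightarrow> unique_trace G \<alpha>)"

definition polycyclic :: "('a, 'b) monoid_scheme \<Rightarrow> bool" where
  "polycyclic G \<longleftrightarrow>
     (\<exists>(n::nat) H. H 0 = {\<one>\<^bsub>G\<^esub>} \<and> H n = carrier G \<and>
        (\<forall>i\<le>n. subgroup (H i) G) \<and>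
        (\<forall>i<n. H i \<lhd> G\<lparr>carrier := H (Suc i)\<rparr> \<and>
               cyclic_group (G\<lparr>carrier := H (Suc i)\<rparr> Mod H i)))"

lemma frag_extend_fun_add:
  "frag_extend (\<lambda>g. f g + f' g) \<alpha> = frag_extend f \<alpha> + frag_extend f' \<alpha>"
  by (simp add: frag_extend_def frag_cmul_distrib2 sum.distrib)

lemma frag_extend_frag_extend:
  "frag_extend f (frag_extend b \<alpha>) = frag_extend (\<lambda>g. frag_extend f (b g)) \<alpha>"
  unfolding frag_extend_def[of b] frag_extend_def[of "\<lambda>g. frag_extend f (b g)"]
  by (simp add: frag_extend_sum frag_extend_cmul o_def)

lemma frag_extend_cong:
  assumes "\<And>g. g \<in> Poly_Mapping.keys \<alpha> \<Longrightarrow> f g = f' g"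
  shows "frag_extend f \<alpha> = frag_extend f' \<alpha>"
  using assms by (simp add: frag_extend_def)

lemma frag_extend_frag_of: "frag_extend frag_of \<alpha> = \<alpha>"
  by (metis frag_expansion)

lemma augmentation_frag_extend:
  "augmentation \<alpha> = Poly_Mapping.lookup (frag_extend (\<lambda>_. frag_of ()) \<alpha>) ()"
  by (simp add: augmentation_def frag_extend_def lookup_sum)

lemma ring_integral_group_ring:
  assumes "group G"
  shows "ring (integral_group_ring G)"
proof -
  interpret group G by fact
  let ?R = "integral_group_ring G"
  have keys_mult: "Poly_Mapping.keys (\<alpha> \<otimes>\<^bsub>?R\<^esub> \<beta>) \<subseteq> carrier G"
    if "Poly_Mapping.keys \<alpha> \<subseteq> carrier G" "Poly_Mapping.keys \<beta> \<subseteq> carrier G" for \<alpha> \<beta>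
    using that unfolding integral_group_ring_def
    by (fastforce dest!: keys_frag_extend[THEN subsetD] simp: keys_frag_of split: if_splits)
  show ?thesis
  proof (intro ringI abelian_groupI monoidI)
    fix \<alpha> \<beta> assume "\<alpha> \<in> carrier ?R" "\<beta> \<in> carrier ?R"
    then show "\<alpha> \<otimes>\<^bsub>?R\<^esub> \<beta> \<in> carrier ?R"
      using keys_mult by (simp add: integral_group_ring_def)
  next
    fix \<alpha> \<beta> assume "\<alpha> \<in> carrier ?R" "\<beta> \<in> carrier ?R"
    then show "\<alpha> \<oplus>\<^bsub>?R\<^esub> \<beta> \<in> carrier ?R"
      using keys_add[of \<alpha> \<beta>] by (auto simp: integral_group_ring_def)
  next
    fix \<alpha> assume "\<alpha> \<in> carrier ?R"
    then show "\<exists>\<beta>\<in>carrier ?R. \<beta> \<oplus>\<^bsub>?R\<^esub> \<alpha> = \<zero>\<^bsub>?R\<^esub>"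
      by (intro bexI[of _ "- \<alpha>"]) (auto simp: integral_group_ring_def)
  next
    fix \<alpha> assume "\<alpha> \<in> carrier ?R"
    then have keys: "Poly_Mapping.keys \<alpha> \<subseteq> carrier G"
      by (simp add: integral_group_ring_def)
    have "frag_extend (\<lambda>h. frag_of (\<one>\<^bsub>G\<^esub> \<otimes>\<^bsub>G\<^esub> h)) \<alpha> = frag_extend frag_of \<alpha>"
      by (rule frag_extend_cong) (use keys in auto)
    then show "\<one>\<^bsub>?R\<^esub> \<otimes>\<^bsub>?R\<^esub> \<alpha> = \<alpha>"
      by (simp add: integral_group_ring_def frag_extend_frag_of)
    have "frag_extend (\<lambda>h. frag_of (h \<otimes>\<^bsub>G\<^esub> \<one>\<^bsub>G\<^esub>)) \<alpha> = frag_extend frag_of \<alpha>"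
      by (rule frag_extend_cong) (use keys in auto)
    then show "\<alpha> \<otimes>\<^bsub>?R\<^esub> \<one>\<^bsub>?R\<^esub> = \<alpha>"
      by (simp add: integral_group_ring_def frag_extend_frag_of)
  next
    fix \<alpha> \<beta> \<gamma> assume "\<alpha> \<in> carrier ?R" "\<beta> \<in> carrier ?R" "\<gamma> \<in> carrier ?R"
    then have "Poly_Mapping.keys \<alpha> \<subseteq> carrier G" "Poly_Mapping.keys \<beta> \<subseteq> carrier G"
      "Poly_Mapping.keys \<gamma> \<subseteq> carrier G"
      by (simp_all add: integral_group_ring_def)
    then show "\<alpha> \<otimes>\<^bsub>?R\<^esub> \<beta> \<otimes>\<^bsub>?R\<^esub> \<gamma> = \<alpha> \<otimes>\<^bsub>?R\<^esub> (\<beta> \<otimes>\<^bsub>?R\<^esub> \<gamma>)"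
      by (auto simp: integral_group_ring_def frag_extend_frag_extend subset_iff m_assoc
          intro!: frag_extend_cong)
  qed (auto simp: integral_group_ring_def keys_frag_of add_ac frag_extend_add frag_extend_fun_add)
qed

lemma augmentation_mult:
  "augmentation (\<alpha> \<otimes>\<^bsub>integral_group_ring G\<^esub> \<beta>) = augmentation \<alpha> * augmentation \<beta>"
proof -
  have aug: "frag_extend (\<lambda>_. frag_cmul c (frag_of ())) \<gamma> = frag_cmul (augmentation \<gamma> * c) (frag_of ())"
    for c and \<gamma> :: "'c \<Rightarrow>\<^sub>0 int"
    by (rule poly_mapping_eqI)
       (simp add: augmentation_def frag_extend_def lookup_sum sum_distrib_right)
  have "frag_extend (\<lambda>_. frag_of ()) (\<alpha> \<otimes>\<^bsub>integral_group_ring G\<^esub> \<beta>)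
      = frag_extend (\<lambda>_. frag_extend (\<lambda>_. frag_of ()) \<beta>) \<alpha>"
    by (simp add: integral_group_ring_def frag_extend_frag_extend)
  also have "\<dots> = frag_cmul (augmentation \<alpha> * augmentation \<beta>) (frag_of ())"
    using aug[of 1 \<beta>] aug[of "augmentation \<beta>" \<alpha>] by simp
  finally show ?thesis
    by (simp add: augmentation_frag_extend[of "_ \<otimes>\<^bsub>_\<^esub> _"])
qed

lemma group_normalized_unit_group:
  assumes "group G"
  shows "group (normalized_unit_group G)"
proof -
  let ?R = "integral_group_ring G"
  interpret R: ring ?R using assms by (rule ring_integral_group_ring)
  interpret U: group "units_of ?R" by (rule R.units_group)
  have aug_one: "augmentation \<one>\<^bsub>?R\<^esub> = 1"
    by (simp add: integral_group_ring_def augmentation_def)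
  have "subgroup {\<alpha> \<in> Units ?R. augmentation \<alpha> = 1} (units_of ?R)"
  proof (rule U.subgroupI)
    show "{\<alpha> \<in> Units ?R. augmentation \<alpha> = 1} \<noteq> {}" using aug_one by auto
  next
    fix \<alpha> assume \<alpha>: "\<alpha> \<in> {\<alpha> \<in> Units ?R. augmentation \<alpha> = 1}"
    then have "augmentation (inv\<^bsub>?R\<^esub> \<alpha>) = augmentation (\<alpha> \<otimes>\<^bsub>?R\<^esub> inv\<^bsub>?R\<^esub> \<alpha>)"
      unfolding augmentation_mult by simp
    then show "inv\<^bsub>units_of ?R\<^esub> \<alpha> \<in> {\<alpha> \<in> Units ?R. augmentation \<alpha> = 1}"
      using \<alpha> aug_one by (simp add: R.units_of_inv)
  qed (auto simp: units_of_carrier units_of_mult augmentation_mult)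
  then show ?thesis
    unfolding normalized_unit_group_def by (rule U.subgroup_imp_group)
qed

end

theory Submission
  imports Defs "HOL-Algebra.Solvable_Groups" "HOL-Number_Theory.Residues"
begin

text \<open>
  Let \<open>\<alpha>\<close> be a unit of augmentation one with \<open>\<alpha>\<^sup>n = 1\<close>. For a prime \<open>p\<close>, letting the cyclic
  rotation act on the words that expand \<open>\<alpha>\<^sup>p\<close> shows that the partial trace of \<open>\<alpha>\<^sup>p\<close> at \<open>g\<close> is,
  modulo \<open>p\<close>, the sum of the partial traces of \<open>\<alpha>\<close> over the classes whose \<open>p\<close>-th power is the class
  of \<open>g\<close>. With \<open>p\<close> large and \<open>q\<close> a power of \<open>p\<close> congruent to 1 modulo \<open>n\<close> we have \<open>\<alpha>\<^sup>q = \<alpha>\<close>, so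
  every class on which \<open>\<alpha>\<close> has nonzero trace has a \<open>q\<close>-th root of the same kind. By finiteness some
  \<open>h\<close> in such a chain of roots is conjugate to a proper power of itself, which forces finite order
  under the maximal condition on subgroups. Hence the partial traces of \<open>\<alpha>\<close> live on torsion classes.

  Torsion classes are separated in finite quotients without the full conjugacy separability theorem.
  If \<open>A\<close> is a torsion-free abelian normal subgroup, \<open>y\<^sup>m = 1\<close> and \<open>(c\<^sup>m y)\<^sup>m = 1\<close> with \<open>c\<close> in \<open>A\<close>, then
  the norm of \<open>c\<close> under \<open>y\<close> is trivial, so \<open>c\<^sup>m\<close> is a coboundary and \<open>c\<^sup>m y\<close> is conjugate to \<open>y\<close>.
  So a normal subgroup that is maximal among those whose quotient separates the conjugacy classes of
  elements \<open>x\<close> with \<open>x\<^sup>m = 1\<close> has a quotient without nontrivial torsion-free abelian normal subgroups, and such a quotient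
  is finite. In this finite quotient the nonzero partial traces of \<open>\<alpha>\<close> are unchanged.
\<close>

section \<open>The maximal condition on subgroups\<close>

text \<open>This is equivalent to the ascending chain condition on subgroups. The form with maximal
  members suits the later arguments, each of which picks a maximal member of a family made for the
  purpose.\<close>

definition noetherian_group :: "('a, 'b) monoid_scheme \<Rightarrow> bool" where
  "noetherian_group G \<longleftrightarrow>
     (\<forall>\<F>. \<F> \<noteq> {} \<longrightarrow> (\<forall>K\<in>\<F>. subgroup K G) \<longrightarrow> (\<exists>M\<in>\<F>. \<forall>K\<in>\<F>. M \<subseteq> K \<longrightarrow> K = M))"

lemma noetherian_groupE:
  assumes "noetherian_group G" "K0 \<in> \<F>" "\<And>K. K \<in> \<F> \<Longrightarrow> subgroup K G"
  obtains M where "M \<in> \<F>" "\<And>K. K \<in> \<F> \<Longrightarrow> M \<subseteq> K \<Longrightarrow> K = M"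
  using assms unfolding noetherian_group_def by (metis empty_iff)

section \<open>Preimages, quotients and extensions\<close>

lemma (in group_hom) subgroup_vimage:
  assumes "subgroup K H"
  shows "subgroup {x \<in> carrier G. h x \<in> K} G"
proof -
  interpret K: subgroup K H by fact
  show ?thesis by (rule G.subgroupI) auto
qed

lemma (in group_hom) normal_vimage:
  assumes "K \<lhd> H"
  shows "{x \<in> carrier G. h x \<in> K} \<lhd> G"
proof -
  interpret K: normal K H by fact
  show ?thesis
    using subgroup_vimage[OF K.is_subgroup] K.inv_op_closed2 by (auto simp: G.normal_inv_iff)
qed

text \<open>Surjectivity makes the preimage map on subgroups injective and monotone, so a member
  with maximal preimage is itself maximal.\<close>

lemma (in group_hom) noetherian_surj_image:
  assumes "h ` carrier G = carrier H" "noetherian_group G"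
  shows "noetherian_group H"
  unfolding noetherian_group_def
proof (intro allI impI)
  fix \<F> assume "\<F> \<noteq> {}" and sub: "\<forall>K\<in>\<F>. subgroup K H"
  then obtain K0 where "K0 \<in> \<F>" by blast
  let ?v = "\<lambda>K. {x \<in> carrier G. h x \<in> K}"
  have image_v: "h ` ?v K = K" if "K \<in> \<F>" for K
    using subgroup.subset[OF sub[rule_format, OF that]] assms(1) by (auto 0 3)
  obtain M where M: "M \<in> ?v ` \<F>" "\<And>K. K \<in> ?v ` \<F> \<Longrightarrow> M \<subseteq> K \<Longrightarrow> K = M"
    using sub subgroup_vimage
    by (rule_tac noetherian_groupE[OF assms(2), of "?v K0" "?v ` \<F>"]) (use \<open>K0 \<in> \<F>\<close> in blast)+
  then obtain L where L: "L \<in> \<F>" "M = ?v L" by blast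
  have "K = L" if "K \<in> \<F>" "L \<subseteq> K" for K
  proof -
    have "?v K = ?v L" using M(2)[of "?v K"] that L by blast
    then show ?thesis using image_v that L by metis
  qed
  then show "\<exists>M\<in>\<F>. \<forall>K\<in>\<F>. M \<subseteq> K \<longrightarrow> K = M" using L by blast
qed

lemma (in normal) quotient_hom: "group_hom G (G Mod H) (\<lambda>a. H #> a)"
  by (intro group_hom.intro group_hom_axioms.intro is_group factorgroup_is_group r_coset_hom_Mod)

lemma (in normal) quotient_surj: "(\<lambda>a. H #> a) ` carrier G = carrier (G Mod H)"
  by (simp add: carrier_FactGroup)

lemma (in normal) quotient_eq_iff:
  assumes "x \<in> carrier G" "y \<in> carrier G"
  shows "H #> x = H #> y \<longleftrightarrow> x \<otimes> inv y \<in> H"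
proof -
  have "H #> x = H #> y \<longleftrightarrow> x \<in> H #> y"
    using assms repr_independence[OF _ _ is_subgroup] rcos_self[OF assms(1) is_subgroup] by metis
  also have "\<dots> \<longleftrightarrow> x \<otimes> inv y \<in> H"
  proof
    assume "x \<in> H #> y"
    then obtain h where "h \<in> H" "x = h \<otimes> y" by (auto simp: r_coset_def)
    then show "x \<otimes> inv y \<in> H" using assms by (simp add: m_assoc)
  next
    assume "x \<otimes> inv y \<in> H"
    moreover have "x = x \<otimes> inv y \<otimes> y" using assms by (simp add: m_assoc)
    ultimately show "x \<in> H #> y" unfolding r_coset_def by blast
  qed
  finally show ?thesis .
qed

text \<open>A member \<open>M\<close> containing \<open>t [^] d\<close>, with \<open>d\<close> least
  over the whole family, is maximal: dividing exponents by \<open>d\<close> leaves remainders that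
  minimality forces to be \<open>0\<close>.\<close>

lemma (in group) cyclic_imp_noetherian:
  assumes "cyclic_group G"
  shows "noetherian_group G"
  unfolding noetherian_group_def
proof (intro allI impI)
  fix \<F> assume "\<F> \<noteq> {}" and sub: "\<forall>K\<in>\<F>. subgroup K G"
  then obtain K0 where "K0 \<in> \<F>" by blast
  obtain t where t: "t \<in> carrier G" and carr: "carrier G = range (\<lambda>n::int. t [^] n)"
    using assms cyclic_group by auto
  let ?P = "\<lambda>d::nat. d > 0 \<and> (\<exists>K\<in>\<F>. t [^] d \<in> K)"
  show "\<exists>M\<in>\<F>. \<forall>K\<in>\<F>. M \<subseteq> K \<longrightarrow> K = M"
  proof (cases "\<exists>d. ?P d")
    case True
    define d where "d = (LEAST d. ?P d)"
    have d: "?P d" unfolding d_def using True by (rule LeastI_ex)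
    then obtain M where M: "M \<in> \<F>" "t [^] d \<in> M" by blast
    have "K \<subseteq> M" if K: "K \<in> \<F>" "M \<subseteq> K" for K
    proof
      fix y assume y: "y \<in> K"
      interpret K: subgroup K G using sub K by blast
      interpret M: subgroup M G using sub M by blast
      obtain z :: int where z: "y = t [^] z" using y K.subset carr by blast
      define q r where "q = z div int d" and "r = z mod int d"
      have eq: "y = (t [^] d) [^] q \<otimes> t [^] r"
        unfolding z q_def r_def using t
        by (metis int_pow_closed int_pow_int int_pow_mult int_pow_pow mult_div_mod_eq)
      have "(t [^] d) [^] q \<in> M" using M(2) M.subgroup_axioms subgroup_int_pow_closed by blast
      moreover have "t [^] r = inv ((t [^] d) [^] q) \<otimes> y"
        unfolding eq using t by (simp add: m_assoc[symmetric])
      ultimately have "t [^] r \<in> K" using y K by auto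
      moreover have "0 \<le> r" "r < int d" using d by (auto simp: r_def)
      ultimately have "nat r = 0"
        using not_less_Least[of "nat r" ?P] K(1) d_def[symmetric]
        by (metis int_pow_int int_nat_eq nat_less_iff neq0_conv)
      then have "r = 0" using \<open>0 \<le> r\<close> by simp
      then show "y \<in> M" using eq \<open>(t [^] d) [^] q \<in> M\<close> t by simp
    qed
    then show ?thesis using M(1) by blast
  next
    \<comment> \<open>Here every member turns out to be trivial, so any of them is maximal.\<close>
    case False
    have "K = {\<one>}" if "K \<in> \<F>" for K
    proof -
      interpret K: subgroup K G using sub that by blast
      have "y = \<one>" if y: "y \<in> K" for y
      proof -
        obtain z :: int where z: "y = t [^] z" using y K.subset carr by blast
        have "t [^] \<bar>z\<bar> \<in> K" using y t unfolding z by (cases "z \<ge> 0") (auto simp: int_pow_neg)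
        then have "t [^] nat \<bar>z\<bar> \<in> K" by (metis abs_ge_zero int_pow_int int_nat_eq)
        then have "z = 0" using False \<open>K \<in> \<F>\<close> by (metis neq0_conv nat_0_iff abs_le_zero_iff)
        then show ?thesis using z by simp
      qed
      then show ?thesis using K.one_closed by blast
    qed
    then show ?thesis using \<open>K0 \<in> \<F>\<close> by blast
  qed
qed

text \<open>Maximise in two stages: first the intersection with \<open>N\<close>, then, among the
  members with this intersection \<open>A\<close>, the image in \<open>G Mod N\<close>. A member
  \<open>K\<close> above the resulting \<open>M\<close> has the same intersection and the same
  image, which forces \<open>K = M\<close>.\<close>

lemma (in group) noetherian_extension:
  assumes "N \<lhd> G" "noetherian_group (G\<lparr>carrier := N\<rparr>)" "noetherian_group (G Mod N)"
  shows "noetherian_group G"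
  unfolding noetherian_group_def
proof (intro allI impI)
  fix \<F> assume "\<F> \<noteq> {}" and sub: "\<forall>K\<in>\<F>. subgroup K G"
  then obtain K0 where "K0 \<in> \<F>" by blast
  interpret N: normal N G by fact
  interpret \<pi>: group_hom G "G Mod N" "\<lambda>a. N #> a" by (rule N.quotient_hom)
  have 1: "subgroup (K \<inter> N) (G\<lparr>carrier := N\<rparr>)" if "K \<in> \<F>" for K
    using sub that subgroup_incl[OF _ N.is_subgroup]
    by (meson inf_le2 subgroups_Inter_pair N.is_subgroup)
  obtain A where A: "A \<in> (\<lambda>K. K \<inter> N) ` \<F>" 
      "\<And>K. K \<in> (\<lambda>K. K \<inter> N) ` \<F> \<Longrightarrow> A \<subseteq> K \<Longrightarrow> K = A"
    by (rule noetherian_groupE[OF assms(2), of "K0 \<inter> N" "(\<lambda>K. K \<inter> N) ` \<F>"])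
      (use \<open>K0 \<in> \<F>\<close> 1 in blast)+
  let ?\<G> = "{K \<in> \<F>. K \<inter> N = A}"
  obtain K1 where "K1 \<in> ?\<G>" using A(1) by blast
  obtain B where B: "B \<in> (\<lambda>K. (\<lambda>a. N #> a) ` K) ` ?\<G>" 
      "\<And>K. K \<in> (\<lambda>K. (\<lambda>a. N #> a) ` K) ` ?\<G> \<Longrightarrow> B \<subseteq> K \<Longrightarrow> K = B"
    by (rule noetherian_groupE[OF assms(3), of "(\<lambda>a. N #> a) ` K1" "(\<lambda>K. (\<lambda>a. N #> a) ` K) ` ?\<G>"])
      (use \<open>K1 \<in> ?\<G>\<close> sub \<pi>.subgroup_img_is_subgroup in blast)+
  then obtain M where M: "M \<in> \<F>" "M \<inter> N = A" "B = (\<lambda>a. N #> a) ` M" by blast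
  have "K \<subseteq> M" if K: "K \<in> \<F>" "M \<subseteq> K" for K
  proof
    fix y assume y: "y \<in> K"
    interpret K: subgroup K G using sub K by blast
    interpret M: subgroup M G using sub M by blast
    have KN: "K \<inter> N = A" using A(2)[of "K \<inter> N"] K M by blast
    then have "(\<lambda>a. N #> a) ` K = B" using B(2)[of "(\<lambda>a. N #> a) ` K"] K M by blast
    then obtain m where m: "m \<in> M" "N #> y = N #> m" using M(3) y by blast
    then have "y \<otimes> inv m \<in> N" using N.quotient_eq_iff y by auto
    then have "y \<otimes> inv m \<in> M" using y m K KN M(2) by auto
    then have "y \<otimes> inv m \<otimes> m \<in> M" using m by blast
    then show "y \<in> M" using m y by (simp add: m_assoc)
  qed
  then show "\<exists>M\<in>\<F>. \<forall>K\<in>\<F>. M \<subseteq> K \<longrightarrow> K = M" using M(1) by blast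
qed

section \<open>Polycyclic groups: the maximal condition and solvability\<close>

lemma (in group) polycyclic_imp_noetherian:
  assumes "polycyclic G"
  shows "noetherian_group G"
proof -
  obtain n H where H0: "H 0 = {\<one>}" and Hn: "H n = carrier G" and sub: "\<forall>i\<le>n. subgroup (H i) G"
    and step: "\<forall>i<n. H i \<lhd> G\<lparr>carrier := H (Suc i)\<rparr> \<and> cyclic_group (G\<lparr>carrier := H (Suc i)\<rparr> Mod H i)"
    using assms unfolding polycyclic_def by blast
  have "noetherian_group (G\<lparr>carrier := H i\<rparr>)" if "i \<le> n" for i
    using that
  proof (induction i)
    case 0
    interpret T: group "G\<lparr>carrier := H 0\<rparr>" using sub subgroup_imp_group by blast
    have "K = {\<one>}" if "subgroup K (G\<lparr>carrier := H 0\<rparr>)" for K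
      using subgroup.subset[OF that] subgroup.one_closed[OF that] H0 by auto
    then show ?case unfolding noetherian_group_def by (metis ex_in_conv)
  next
    case (Suc i)
    interpret S: group "G\<lparr>carrier := H (Suc i)\<rparr>" using sub Suc subgroup_imp_group by blast
    have st: "H i \<lhd> G\<lparr>carrier := H (Suc i)\<rparr>" "cyclic_group (G\<lparr>carrier := H (Suc i)\<rparr> Mod H i)"
      using step Suc by auto
    show ?case
      using S.noetherian_extension[OF st(1)] Suc
        group.cyclic_imp_noetherian[OF normal.factorgroup_is_group[OF st(1)] st(2)] by auto
  qed
  then show ?thesis
    using Hn by (metis order_refl partial_object.surjective partial_object.update_convs(1))
qed

lemma (in group) polycyclic_imp_solvable:
  assumes "polycyclic G"
  shows "solvable G"
proof -
  obtain n H where H0: "H 0 = {\<one>}" and Hn: "H n = carrier G" and sub: "\<forall>i\<le>n. subgroup (H i) G"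
    and step: "\<forall>i<n. H i \<lhd> G\<lparr>carrier := H (Suc i)\<rparr> \<and> cyclic_group (G\<lparr>carrier := H (Suc i)\<rparr> Mod H i)"
    using assms unfolding polycyclic_def by blast
  have "solvable_seq G (H i)" if "i \<le> n" for i
    using that
  proof (induction i)
    case 0
    then show ?case using H0 solvable_seq.unity by metis
  next
    case (Suc i)
    have st: "H i \<lhd> G\<lparr>carrier := H (Suc i)\<rparr>" "cyclic_group (G\<lparr>carrier := H (Suc i)\<rparr> Mod H i)"
      using step Suc by auto
    show ?case
      using group.cyclic_imp_abelian_group[OF normal.factorgroup_is_group[OF st(1)] st(2)] Suc sub
      by (intro solvable_seq.extension[OF _ st(1)]) auto
  qed
  then show ?thesis using Hn by (metis solvable_def order_refl)
qed

section \<open>Conjugation and powers\<close>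

lemma (in group) conj_group_hom:
  assumes "x \<in> carrier G"
  shows "group_hom G G (\<lambda>y. x \<otimes> y \<otimes> inv x)"
proof (intro group_hom.intro group_hom_axioms.intro is_group homI)
  fix a b assume "a \<in> carrier G" "b \<in> carrier G"
  then show "x \<otimes> (a \<otimes> b) \<otimes> inv x = x \<otimes> a \<otimes> inv x \<otimes> (x \<otimes> b \<otimes> inv x)"
    using assms by (simp add: m_assoc inv_solve_left)
qed (use assms in auto)

lemma (in group) conj_nat_pow:
  fixes n :: nat
  assumes "x \<in> carrier G" "y \<in> carrier G"
  shows "(x \<otimes> y \<otimes> inv x) [^] n = x \<otimes> y [^] n \<otimes> inv x"
  using group_hom.hom_nat_pow[OF conj_group_hom] assms by simp

lemma (in group) conj_int_pow:
  fixes n :: int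
  assumes "x \<in> carrier G" "y \<in> carrier G"
  shows "(x \<otimes> y \<otimes> inv x) [^] n = x \<otimes> y [^] n \<otimes> inv x"
  using group_hom.hom_int_pow[OF conj_group_hom] assms by simp

lemma (in group) conj_by_mult:
  assumes "a \<in> carrier G" "b \<in> carrier G" "y \<in> carrier G"
  shows "(a \<otimes> b) \<otimes> y \<otimes> inv (a \<otimes> b) = a \<otimes> (b \<otimes> y \<otimes> inv b) \<otimes> inv a"
  using assms by (simp add: m_assoc inv_mult_group)

text \<open>The subgroups \<open>x\<^sup>-\<^sup>i \<langle>g\<rangle> x\<^sup>i\<close> form an ascending chain, which must become stationary.\<close>
lemma (in group) noetherian_conj_to_power:
  assumes "noetherian_group G" "x \<in> carrier G" "g \<in> carrier G"
    and "x \<otimes> g \<otimes> inv x = g [^] (q::nat)" "q \<ge> 2"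
  shows "\<exists>n::nat. n > 0 \<and> g [^] n = \<one>"
proof -
  define c where "c i y = x [^] (i::nat) \<otimes> y \<otimes> inv (x [^] i)" for i y
  define K where "K i = {y \<in> carrier G. c i y \<in> range (\<lambda>j::int. g [^] j)}" for i
  have c_Suc: "c (Suc i) y = x \<otimes> c i y \<otimes> inv x" if "y \<in> carrier G" for i y
    using that assms(2) conj_by_mult[of x "x [^] i" y]
    by (simp only: c_def nat_pow_Suc2 nat_pow_closed)
  have sub: "subgroup (K i) G" for i
    unfolding K_def c_def using assms(2,3)
    by (intro group_hom.subgroup_vimage[OF conj_group_hom] subgroup_of_powers) auto
  have pow: "x \<otimes> g [^] j \<otimes> inv x = g [^] (int q * j)" for j :: int
    using conj_int_pow[of x g j] assms(2,3,4) by (simp flip: int_pow_int add: int_pow_pow)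
  have mono: "K i \<subseteq> K (Suc i)" for i
    unfolding K_def using c_Suc pow by auto
  obtain M where M: "M \<in> range K" "\<And>L. L \<in> range K \<Longrightarrow> M \<subseteq> L \<Longrightarrow> L = M"
    by (rule noetherian_groupE[OF assms(1), of "K 0" "range K"]) (use sub in auto)
  then obtain i where "M = K i" by blast
  then have i: "K (Suc i) = K i" using M(2)[of "K (Suc i)"] mono[of i] by simp
  \<comment> \<open>Conjugating \<open>y\<close> by \<open>x [^] Suc i\<close> gives
    \<open>g\<close>, so \<open>y\<close> lies in \<open>K (Suc i)\<close>. Stationarity puts it in
    \<open>K i\<close>, and one further conjugation by \<open>x\<close> yields
    \<open>g = g [^] (q * j)\<close>.\<close>
  define y where "y = inv (x [^] Suc i) \<otimes> g \<otimes> x [^] Suc i"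
  have y: "y \<in> carrier G" using assms(2,3) by (simp add: y_def)
  have "c (Suc i) y = g"
    using assms(2,3) unfolding c_def y_def by (simp add: m_assoc inv_solve_left del: nat_pow_Suc)
       (simp add: m_assoc[symmetric] del: nat_pow_Suc)
  moreover have "g = g [^] (1::int)" using assms(3) by simp
  ultimately have "y \<in> K (Suc i)" using y unfolding K_def by blast
  then obtain j :: int where "c i y = g [^] j" using i by (auto simp: K_def)
  then have "g [^] (int q * j) = g [^] (1::int)"
    using c_Suc[OF y, of i] \<open>c (Suc i) y = g\<close> pow assms(3) by simp
  \<comment> \<open>\<open>ord g\<close> is \<open>0\<close> exactly when \<open>g\<close> has
    infinite order, so it suffices that it divides a nonzero integer.\<close>
  then have "int (ord g) dvd 1 - int q * j" using int_pow_eq assms(3) by blast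
  moreover have "1 - int q * j \<noteq> 0"
    using assms(5) by (metis eq_iff_diff_eq_0 int_dvd_int_iff nat_dvd_1_iff_1 dvd_triv_left of_nat_1 Suc_1 not_less_eq_eq order_refl)
  ultimately have "ord g \<noteq> 0" by (metis dvd_0_left_iff of_nat_0)
  then show ?thesis using assms(3) pow_ord_eq_1 by blast
qed

section \<open>Conjugacy of torsion elements\<close>

text \<open>
  In additive notation \<open>a\<close> is the sum of the partial norms \<open>c + \<sigma> c + \<dots> + \<sigma>\<^sup>i\<^sup>-\<^sup>1 c\<close> over \<open>i < m\<close>, on each of
  which \<open>1 - \<sigma>\<close> takes the value \<open>c - \<sigma>\<^sup>i c\<close>.
\<close>
lemma (in comm_group) norm_trivial_imp_coboundary:
  fixes c :: 'a and \<sigma> :: "'a \<Rightarrow> 'a"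
  defines "N \<equiv> (\<lambda>n. finprod G (\<lambda>i. (\<sigma> ^^ i) c) {..<n})"
  assumes "\<sigma> \<in> hom G G" "c \<in> carrier G" "N m = \<one>"
  shows "\<exists>a\<in>carrier G. a = c [^] m \<otimes> \<sigma> a"
proof -
  interpret \<sigma>: group_hom G G \<sigma>
    using assms(2) by (intro group_hom.intro group_hom_axioms.intro is_group)
  have sc: "(\<sigma> ^^ i) c \<in> carrier G" for i
    by (induction i) (use assms in auto)
  have N_closed: "N n \<in> carrier G" for n
    unfolding N_def using sc by auto
  have N_Suc: "N (Suc n) = N n \<otimes> (\<sigma> ^^ n) c" for n
    unfolding N_def using sc by (simp add: lessThan_Suc m_comm Pi_def)
  have N_0: "N 0 = \<one>" by (simp add: N_def)
  have N_sigma: "N n \<otimes> (\<sigma> ^^ n) c = c \<otimes> \<sigma> (N n)" for n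
  proof (induction n)
    case 0
    then show ?case using assms(3) by (simp add: N_0)
  next
    case (Suc n)
    have "N (Suc n) \<otimes> (\<sigma> ^^ Suc n) c = c \<otimes> \<sigma> (N n) \<otimes> \<sigma> ((\<sigma> ^^ n) c)"
      using Suc by (simp add: N_Suc)
    then show ?case using sc N_closed assms(3) by (simp add: N_Suc m_assoc)
  qed
  define P where "P n = finprod G N {..<n}" for n
  have P_closed: "P n \<in> carrier G" for n
    unfolding P_def using N_closed by auto
  have P_Suc: "P (Suc n) = P n \<otimes> N n" for n
    unfolding P_def using N_closed by (simp add: lessThan_Suc m_comm Pi_def)
  \<comment> \<open>Keeping the factor \<open>N n\<close> makes the identity inductive; at
    \<open>n = m\<close> it disappears and \<open>P m\<close> is the required element.\<close>
  have "P n \<otimes> N n = c [^] n \<otimes> \<sigma> (P n)" for n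
  proof (induction n)
    case 0
    then show ?case by (simp add: P_def N_0)
  next
    case (Suc n)
    have "P (Suc n) \<otimes> N (Suc n) = (P n \<otimes> N n) \<otimes> (N n \<otimes> (\<sigma> ^^ n) c)"
      by (simp add: P_Suc N_Suc)
    also have "\<dots> = (c [^] n \<otimes> \<sigma> (P n)) \<otimes> (c \<otimes> \<sigma> (N n))"
      by (simp only: Suc N_sigma)
    also have "\<dots> = c [^] Suc n \<otimes> \<sigma> (P (Suc n))"
      using N_closed P_closed assms(3) by (simp add: P_Suc m_ac)
    finally show ?case .
  qed
  from this[of m] show ?thesis
    using P_closed assms(4) by (intro bexI[of _ "P m"]) (simp_all add: N_def)
qed

text \<open>As a conjugate of \<open>x\<close>, the element \<open>c [^] m \<otimes> y\<close> has
  trivial \<open>m\<close>-th power. That power is the norm of \<open>c [^] m\<close> under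
  \<open>y\<close>, which is the \<open>m\<close>-th power of the norm of \<open>c\<close>.
  Torsion-freeness removes the exponent, and \<open>norm_trivial_imp_coboundary\<close> supplies the
  conjugating element.\<close>

lemma (in group) conj_of_torsion_mod_powers:
  fixes m :: nat
  assumes "A \<lhd> G" and comm: "\<And>a b. a \<in> A \<Longrightarrow> b \<in> A \<Longrightarrow> a \<otimes> b = b \<otimes> a"
    and torsion_free: "\<And>a n. a \<in> A \<Longrightarrow> (n::nat) > 0 \<Longrightarrow> a [^] n = \<one> \<Longrightarrow> a = \<one>"
    and "x \<in> carrier G" "y \<in> carrier G" "x [^] m = \<one>" "y [^] m = \<one>" "m > 0"
    and "k \<in> carrier G" "c \<in> A" "k \<otimes> x \<otimes> inv k = c [^] m \<otimes> y"
  shows "\<exists>k'\<in>carrier G. k' \<otimes> x \<otimes> inv k' = y"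
proof -
  interpret N: normal A G by fact
  let ?A = "G\<lparr>carrier := A\<rparr>"
  interpret A: comm_group ?A
    using N.subgroup_is_group[OF is_group] comm by (intro group.group_comm_groupI) auto
  define \<sigma> where "\<sigma> = (\<lambda>a. y \<otimes> a \<otimes> inv y)"
  interpret \<sigma>: group_hom G G \<sigma> unfolding \<sigma>_def using assms by (intro conj_group_hom)
  have \<sigma>_hom: "\<sigma> \<in> hom ?A ?A"
    using N.inv_op_closed2 assms by (auto simp: hom_def \<sigma>_def[symmetric]) (auto simp: \<sigma>_def)
  have \<sigma>_pow: "(\<sigma> ^^ n) a = y [^] n \<otimes> a \<otimes> inv (y [^] n)" if "a \<in> A" for n a
  proof (induction n)
    case 0
    then show ?case using that by simp
  next
    case (Suc n)
    have "(\<sigma> ^^ Suc n) a = \<sigma> (y [^] n \<otimes> a \<otimes> inv (y [^] n))"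
      by (simp only: funpow.simps o_apply Suc)
    then have "(\<sigma> ^^ Suc n) a = y \<otimes> (y [^] n \<otimes> a \<otimes> inv (y [^] n)) \<otimes> inv y"
      by (simp only: \<sigma>_def)
    then show ?case
      using that assms(5) conj_by_mult[of y "y [^] n" a]
      by (simp only: nat_pow_Suc2 nat_pow_closed N.mem_carrier)
  qed
  have s_closed: "(\<sigma> ^^ n) a \<in> A" if "a \<in> A" for n a
    using that \<sigma>_hom by (induction n) (auto simp: hom_def Pi_def)
  define N where "N n a = finprod ?A (\<lambda>i. (\<sigma> ^^ i) a) {..<n}" for n a
  have N_closed: "N n a \<in> A" if "a \<in> A" for n a
    unfolding N_def using A.finprod_closed[of "\<lambda>i. (\<sigma> ^^ i) a"] s_closed[OF that] by auto
  have N_Suc: "N (Suc n) a = N n a \<otimes> (\<sigma> ^^ n) a" if "a \<in> A" for n a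
    unfolding N_def using s_closed[OF that] A.finprod_closed[of "\<lambda>i. (\<sigma> ^^ i) a" "{..<n}"] comm
    by (simp add: lessThan_Suc Pi_def)
  have N_0: "N 0 a = \<one>" for a by (simp add: N_def)
  \<comment> \<open>Moving every \<open>y\<close> to the right past the later factors
    \<open>a\<close> conjugates them, which collects the norm in front.\<close>
  have pow_mult: "(a \<otimes> y) [^] n = N n a \<otimes> y [^] n" if "a \<in> A" for n :: nat and a
  proof (induction n)
    case 0
    then show ?case by (simp add: N_0)
  next
    case (Suc n)
    then show ?case
      using that assms(5) N_closed[OF that] by (simp add: N_Suc \<sigma>_pow m_assoc) (simp add: m_assoc[symmetric])
  qed
  have N_pow: "N n (a [^] j) = N n a [^] j" if "a \<in> A" for n j :: nat and a
  proof (induction n)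
    case 0
    then show ?case by (simp add: N_0)
  next
    case (Suc n)
    have "(\<sigma> ^^ n) (a [^] j) = (\<sigma> ^^ n) a [^] j"
    proof (induction n)
      case (Suc n)
      then show ?case using s_closed[OF that] by (simp add: \<sigma>.hom_nat_pow)
    qed simp
    moreover have "a [^] j \<in> A" using that by (induction j) auto
    ultimately show ?case
      using Suc that s_closed N_closed by (simp add: N_Suc pow_mult_distrib comm)
  qed
  have cm: "c [^] m \<in> A" using A.nat_pow_closed[of c m] assms(10) nat_pow_consistent[of c m A] by simp
  have "(c [^] m \<otimes> y) [^] m = \<one>"
    using assms conj_nat_pow[of k x m] by (simp flip: assms(11))
  then have "N m c [^] m = \<one>"
    using pow_mult[OF cm] N_pow[OF assms(10)] N_closed[OF assms(10)] assms(7) by simp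
  then have "N m c = \<one>" using torsion_free N_closed assms by blast
  then obtain a where a: "a \<in> A" "a = c [^] m \<otimes> \<sigma> a"
    using A.norm_trivial_imp_coboundary[OF \<sigma>_hom, of c m] assms(10)
    by (auto simp: N_def simp flip: nat_pow_consistent)
  \<comment> \<open>This is the coboundary equation with \<open>\<sigma>\<close> written out as
    conjugation by \<open>y\<close>.\<close>
  have "a \<otimes> y \<otimes> inv a = c [^] m \<otimes> y"
  proof -
    have "a \<otimes> y = c [^] m \<otimes> y \<otimes> a"
    proof -
      have "a \<otimes> y = c [^] m \<otimes> \<sigma> a \<otimes> y" using a(2) by simp
      also have "\<dots> = c [^] m \<otimes> y \<otimes> a"
        unfolding \<sigma>_def using a(1) assms(5) cm by (simp add: m_assoc)
      finally show ?thesis .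
    qed
    then show ?thesis using a(1) assms(5) cm by (simp add: m_assoc)
  qed
  then have "k \<otimes> x \<otimes> inv k = a \<otimes> y \<otimes> inv a" using assms by simp
  then have "inv a \<otimes> (k \<otimes> x \<otimes> inv k) \<otimes> inv (inv a) = y"
    using a(1) assms(5) by (simp add: m_assoc) (simp add: m_assoc[symmetric])
  then show ?thesis
    using conj_by_mult[of "inv a" k x] a(1) assms by (intro bexI[of _ "inv a \<otimes> k"]) auto
qed

section \<open>Torsion-free abelian normal subgroups of infinite solvable groups\<close>

lemma (in group) noetherian_torsion_bounded:
  assumes "noetherian_group G" "subgroup Z G"
    and comm: "\<And>a b. a \<in> Z \<Longrightarrow> b \<in> Z \<Longrightarrow> a \<otimes> b = b \<otimes> a"
  shows "\<exists>e::nat. e > 0 \<and> (\<forall>z\<in>Z. \<forall>n::nat. n > 0 \<longrightarrow> z [^] n = \<one> \<longrightarrow> z [^] e = \<one>)"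
proof -
  interpret Z: subgroup Z G by fact
  \<comment> \<open>These subgroups are directed: \<open>?T e\<close> and \<open>?T n\<close> both
    lie in \<open>?T (e * n)\<close>. A maximal one therefore contains all the others.\<close>
  let ?T = "\<lambda>n::nat. {z \<in> Z. z [^] n = \<one>}"
  have sub: "subgroup (?T n) G" for n
    by (rule subgroupI) (auto simp: nat_pow_inv pow_mult_distrib comm intro!: exI[of _ \<one>])
  obtain M where M: "M \<in> ?T ` {0<..}" "\<And>L. L \<in> ?T ` {0<..} \<Longrightarrow> M \<subseteq> L \<Longrightarrow> L = M"
    by (rule noetherian_groupE[OF assms(1), of "?T 1" "?T ` {0<..}"]) (rule imageI, simp, use sub in auto)
  then obtain e where e: "e > 0" "M = ?T e" by blast
  have "z [^] e = \<one>" if "z \<in> Z" "n > 0" "z [^] n = \<one>" for z and n :: nat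
  proof -
    have zc: "z \<in> carrier G" using that(1) by simp
    have "?T (e * n) \<in> ?T ` {0<..}" using e(1) that(2) by (intro imageI) simp
    moreover have "?T e \<subseteq> ?T (e * n)" by (auto simp flip: nat_pow_pow)
    ultimately have "?T (e * n) = ?T e" using M(2) e(2) by simp
    moreover have "z [^] (n * e) = \<one>" using that(3) by (simp only: nat_pow_pow[OF zc, symmetric] nat_pow_one)
    then have "z \<in> ?T (e * n)" using that(1) by (simp add: mult.commute)
    ultimately have "z \<in> ?T e" by (rule subst)
    then show ?thesis by simp
  qed
  then show ?thesis using e(1) by blast
qed

lemma (in group) powers_normal:
  fixes m :: nat
  assumes "A \<lhd> G" and comm: "\<And>a b. a \<in> A \<Longrightarrow> b \<in> A \<Longrightarrow> a \<otimes> b = b \<otimes> a"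
  shows "(\<lambda>a. a [^] m) ` A \<lhd> G"
proof -
  interpret A: normal A G by fact
  have "subgroup ((\<lambda>a. a [^] m) ` A) G"
  proof (rule subgroupI)
    fix a b assume "a \<in> (\<lambda>a. a [^] m) ` A" "b \<in> (\<lambda>a. a [^] m) ` A"
    then show "a \<otimes> b \<in> (\<lambda>a. a [^] m) ` A"
      by (auto simp: pow_mult_distrib[symmetric] comm)
  next
    show "(\<lambda>a. a [^] m) ` A \<noteq> {}" using A.one_closed by blast
  qed (auto simp: nat_pow_inv[symmetric])
  moreover have "x \<otimes> b \<otimes> inv x \<in> (\<lambda>a. a [^] m) ` A" if "x \<in> carrier G" "b \<in> (\<lambda>a. a [^] m) ` A" for x b
    using that conj_nat_pow[symmetric] A.inv_op_closed2 by auto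
  ultimately show ?thesis by (auto simp: normal_inv_iff)
qed

text \<open>
  The commutators of \<open>d\<^sup>k\<close> with \<open>x\<close> lie in the finite set \<open>[D, D]\<close>, so two of them with
  \<open>k \<le> |[D, D]|\<close> coincide.
\<close>
lemma (in group) pow_central_of_finite_derived:
  assumes "subgroup D G" "finite (derived G D)" "d \<in> D" "x \<in> D"
  shows "d [^] (fact (card (derived G D)) :: nat) \<otimes> x = x \<otimes> d [^] (fact (card (derived G D)) :: nat)"
proof -
  interpret D: subgroup D G by fact
  let ?E = "derived G D"
  have dk: "d [^] k \<in> D" for k :: nat using assms(3) by (induction k) auto
  have "d [^] k \<otimes> x \<otimes> inv (d [^] k) \<otimes> inv x \<in> ?E" for k :: nat
    unfolding derived_def using dk[of k] assms(4) by (intro generate.incl) blast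
  then have "(\<lambda>k::nat. d [^] k \<otimes> x \<otimes> inv (d [^] k) \<otimes> inv x) ` {..card ?E} \<subseteq> ?E" by blast
  then have "\<not> inj_on (\<lambda>k::nat. d [^] k \<otimes> x \<otimes> inv (d [^] k) \<otimes> inv x) {..card ?E}"
    using card_inj_on_le[OF _ _ assms(2)] by fastforce
  then obtain i j where ij: "i < j" "j \<le> card ?E"
    "d [^] i \<otimes> x \<otimes> inv (d [^] i) \<otimes> inv x = d [^] j \<otimes> x \<otimes> inv (d [^] j) \<otimes> inv x"
    by (metis (no_types, lifting) atMost_iff linorder_inj_onI' )
  define k where "k = j - i"
  have [simp]: "d \<in> carrier G" "x \<in> carrier G" using assms by auto
  \<comment> \<open>Equal commutators mean equal conjugates of \<open>x\<close>, so
    \<open>d [^] (j - i)\<close> commutes with \<open>x\<close>.\<close>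
  have "d [^] i \<otimes> x \<otimes> inv (d [^] i) = d [^] j \<otimes> x \<otimes> inv (d [^] j)"
    using ij(3) by simp
  also have "d [^] j = d [^] i \<otimes> d [^] k"
    using ij(1) by (simp add: k_def nat_pow_mult)
  finally have "x = d [^] k \<otimes> x \<otimes> inv (d [^] k)"
    by (simp add: conj_by_mult)
  then have comm: "x \<otimes> d [^] k = d [^] k \<otimes> x" 
    by (metis D.mem_carrier assms(4) dk inv_solve_right' m_closed)
  \<comment> \<open>The exponent \<open>k\<close> depends on \<open>x\<close>, but it is at most
    \<open>card ?E\<close>; the factorial is a multiple of every such \<open>k\<close>, which makes
    the final exponent uniform in \<open>x\<close>.\<close>
  obtain l where l: "(fact (card ?E) :: nat) = k * l"
    using ij by (metis diff_le_self dvdE dvd_fact k_def le_trans less_eq_Suc_le zero_less_diff One_nat_def)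
  have "(d [^] k) [^] l \<otimes> x = x \<otimes> (d [^] k) [^] l"
  proof (induction l)
    case (Suc l)
    have "(d [^] k) [^] Suc l \<otimes> x = (d [^] k) [^] l \<otimes> x \<otimes> d [^] k"
      by (simp add: m_assoc comm)
    then show ?case by (simp add: Suc m_assoc)
  qed simp
  then show ?thesis by (simp add: l nat_pow_pow)
qed

text \<open>A subgroup \<open>K\<close> between \<open>derived G D\<close> and \<open>D\<close> is
  normalised by \<open>D\<close>, so its product with the cyclic group of \<open>d\<close> is a
  subgroup. It is finite because the exponents of \<open>d\<close> matter only modulo
  \<open>n\<close>.\<close>

lemma (in group) adjoin_torsion_finite:
  assumes "subgroup D G" "subgroup K G" "finite K" "derived G D \<subseteq> K" "K \<subseteq> D"
    and d: "d \<in> D" "d [^] (n::nat) = \<one>" "n > 0"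
  obtains L where "subgroup L G" "finite L" "K \<subseteq> L" "L \<subseteq> D" "d \<in> L"
proof -
  interpret D: subgroup D G by fact
  interpret K: subgroup K G by fact
  let ?L = "(\<lambda>(k, j). k \<otimes> d [^] (j::nat)) ` (K \<times> UNIV)"
  have dc: "d \<in> carrier G" and dk: "d [^] k \<in> D" for k :: nat
    using d(1) by (auto, induction k, auto)
  have conj: "a \<otimes> k \<otimes> inv a \<in> K" if "a \<in> D" "k \<in> K" for a k
  proof -
    have "k \<in> D" using that assms(5) by blast
    then have "a \<otimes> k \<otimes> inv a \<otimes> inv k \<in> K"
      using that assms(4) unfolding derived_def by (intro subsetD[OF assms(4)[unfolded derived_def]] generate.incl) blast
    then have "a \<otimes> k \<otimes> inv a \<otimes> inv k \<otimes> k \<in> K" using that by blast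
    then show ?thesis using that by (simp add: m_assoc)
  qed
  have pow_mod: "d [^] j = d [^] (j mod n)" for j :: nat
  proof -
    have "d [^] j = d [^] (n * (j div n)) \<otimes> d [^] (j mod n)"
      using dc by (simp add: nat_pow_mult)
    also have "d [^] (n * (j div n)) = \<one>" using d(2) dc by (simp flip: nat_pow_pow)
    finally show ?thesis using dc by simp
  qed
  have "?L \<subseteq> (\<lambda>(k, j). k \<otimes> d [^] (j::nat)) ` (K \<times> {..<n})"
  proof clarify
    fix k and j :: nat assume "k \<in> K"
    then show "k \<otimes> d [^] j \<in> (\<lambda>(k, j). k \<otimes> d [^] (j::nat)) ` (K \<times> {..<n})"
      using pow_mod[of j] d(3) by (intro image_eqI[of _ _ "(k, j mod n)"]) auto
  qed
  then have 1: "finite ?L" using assms(3) by (meson finite_SigmaI finite_imageI finite_lessThan finite_subset)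
  \<comment> \<open>\<open>?L\<close> is built from natural exponents, so inverses must be expressed
    as nonnegative powers.\<close>
  have inv_pow: "inv (d [^] j) = d [^] ((n - 1) * j)" for j :: nat
  proof (rule inv_unique'[symmetric])
    have "d [^] (n * j) = \<one>" using d(2) dc by (simp flip: nat_pow_pow)
    moreover have "j + (n - 1) * j = n * j" "(n - 1) * j + j = n * j"
      using d(3) by (cases n; simp)+
    ultimately show "d [^] j \<otimes> d [^] ((n - 1) * j) = \<one>" "d [^] ((n - 1) * j) \<otimes> d [^] j = \<one>"
      by (simp_all only: nat_pow_mult[OF dc])
  qed (use dc in auto)
  have 2: "subgroup ?L G"
  proof (rule subgroupI)
    fix a assume "a \<in> ?L"
    then obtain k and j :: nat where a: "k \<in> K" "a = k \<otimes> d [^] j" by auto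
    have "inv a = (inv (d [^] j) \<otimes> inv k \<otimes> inv (inv (d [^] j))) \<otimes> d [^] ((n - 1) * j)"
      unfolding inv_pow[symmetric] using a dc by (simp add: inv_mult_group m_assoc)
    moreover have "inv (d [^] j) \<otimes> inv k \<otimes> inv (inv (d [^] j)) \<in> K"
      using a dk by (intro conj) auto
    ultimately show "inv a \<in> ?L" by auto
  next
    fix a b assume "a \<in> ?L" "b \<in> ?L"
    then obtain k k' and j j' :: nat where a: "k \<in> K" "a = k \<otimes> d [^] j" "k' \<in> K" "b = k' \<otimes> d [^] j'" by auto
    have "a \<otimes> b = (k \<otimes> (d [^] j \<otimes> k' \<otimes> inv (d [^] j))) \<otimes> d [^] (j + j')"
      using a dc by (simp add: m_assoc flip: nat_pow_mult) (simp add: m_assoc[symmetric])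
    moreover have "k \<otimes> (d [^] j \<otimes> k' \<otimes> inv (d [^] j)) \<in> K"
      using a dk conj by auto
    ultimately show "a \<otimes> b \<in> ?L" by auto
  next
    show "?L \<noteq> {}" using K.one_closed by blast
  qed (use dc in auto)
  have 3: "K \<subseteq> ?L"
  proof
    fix k assume "k \<in> K"
    then show "k \<in> ?L" by (intro image_eqI[of _ _ "(k, 0)"]) auto
  qed
  have 4: "d \<in> ?L"
    using dc K.one_closed by (intro image_eqI[of _ _ "(\<one>, 1)"]) auto
  have 5: "?L \<subseteq> D" using dk assms(5) by auto
  show thesis by (rule that[OF 2 1 3 5 4])
qed

text \<open>Among the finite subgroups between \<open>derived G D\<close> and \<open>D\<close> there
  is a maximal one, and by \<open>adjoin_torsion_finite\<close> it absorbs every element of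
  \<open>D\<close>.\<close>

lemma (in group) torsion_finite_by_abelian_finite:
  assumes "noetherian_group G" "subgroup D G" "finite (derived G D)"
    and torsion: "\<And>d. d \<in> D \<Longrightarrow> \<exists>n::nat. n > 0 \<and> d [^] n = \<one>"
  shows "finite D"
proof -
  interpret D: subgroup D G by fact
  let ?F = "{K. subgroup K G \<and> finite K \<and> derived G D \<subseteq> K \<and> K \<subseteq> D}"
  have "derived G D \<in> ?F"
    using derived_is_subgroup[OF D.subset] derived_incl[OF order_refl assms(2)] assms(3) by blast
  then obtain K where K: "K \<in> ?F" "\<And>L. L \<in> ?F \<Longrightarrow> K \<subseteq> L \<Longrightarrow> L = K"
    by (rule noetherian_groupE[OF assms(1)]) auto
  have "D \<subseteq> K"
  proof
    fix d assume d: "d \<in> D"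
    obtain n :: nat where "n > 0" "d [^] n = \<one>" using torsion[OF d] by blast
    then obtain L where "subgroup L G" "finite L" "K \<subseteq> L" "L \<subseteq> D" "d \<in> L"
      using adjoin_torsion_finite[OF assms(2), of K d n] K(1) d by blast
    then show "d \<in> K" using K by blast
  qed
  then show ?thesis using K(1) finite_subset by blast
qed

text \<open>
  Take \<open>D\<close> to be the last infinite term of the derived series. If a power subgroup of its centre \<open>Z\<close>
  were trivial, \<open>D\<close> would be torsion with finite derived subgroup, hence finite.
\<close>
lemma (in group) infinite_imp_torsion_free_abelian_normal:
  assumes "noetherian_group G" "solvable G" "infinite (carrier G)"
  obtains A where "A \<lhd> G" "A \<noteq> {\<one>}" "\<And>a b. a \<in> A \<Longrightarrow> b \<in> A \<Longrightarrow> a \<otimes> b = b \<otimes> a"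
    "\<And>a n. a \<in> A \<Longrightarrow> (n::nat) > 0 \<Longrightarrow> a [^] n = \<one> \<Longrightarrow> a = \<one>"
proof -
  let ?D = "\<lambda>j. (derived G ^^ j) (carrier G)"
  obtain r where "?D r = {\<one>}" using assms(2) solvable_iff_trivial_derived_seq by auto
  then have ex: "finite (?D r)" by simp
  define s where "s = (LEAST j. finite (?D j))"
  have s: "finite (?D s)" "\<And>j. j < s \<Longrightarrow> infinite (?D j)"
    unfolding s_def using LeastI[of "\<lambda>j. finite (?D j)", OF ex] not_less_Least by blast+
  then obtain j where j: "s = Suc j" using assms(3) by (cases s) auto
  define D where "D = ?D j"
  have D: "infinite D" "finite (derived G D)" using s j by (auto simp: D_def)
  have D_normal: "?D i \<lhd> G" for i by (induction i) (auto intro: normal_self derived_is_normal)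
  interpret D: normal D G unfolding D_def by (rule D_normal)
  \<comment> \<open>The centre of \<open>D\<close> is characteristic in the normal subgroup
    \<open>D\<close>, hence normal in \<open>G\<close>.\<close>
  define Z where "Z = {z \<in> D. \<forall>d\<in>D. z \<otimes> d = d \<otimes> z}"
  have Z_I: "z \<in> Z" if "z \<in> D" "\<And>d. d \<in> D \<Longrightarrow> z \<otimes> d = d \<otimes> z" for z
    using that unfolding Z_def by blast
  have Z_D: "z \<in> D" if "z \<in> Z" for z using that unfolding Z_def by blast
  have Z_central: "z \<otimes> d = d \<otimes> z" if "z \<in> Z" "d \<in> D" for z d using that unfolding Z_def by blast
  have Z_normal: "Z \<lhd> G"
    unfolding normal_inv_iff
  proof (intro conjI ballI)
    show "subgroup Z G"
    proof (rule subgroupI)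
      fix a b assume ab: "a \<in> Z" "b \<in> Z"
      have "a \<otimes> b \<otimes> d = d \<otimes> (a \<otimes> b)" if "d \<in> D" for d
      proof -
        have eq: "a \<otimes> d = d \<otimes> a" "b \<otimes> d = d \<otimes> b" and "a \<in> D" "b \<in> D"
          using Z_central Z_D ab that by blast+
        then have carr: "a \<in> carrier G" "b \<in> carrier G" "d \<in> carrier G" using that by auto
        then have "a \<otimes> b \<otimes> d = a \<otimes> d \<otimes> b" using eq(2) by (simp only: m_assoc)
        then show ?thesis using carr eq(1) by (simp add: m_assoc)
      qed
      then show "a \<otimes> b \<in> Z" using Z_D ab by (intro Z_I D.m_closed) blast+
    next
      fix a assume a: "a \<in> Z"
      have "inv a \<otimes> d = d \<otimes> inv a" if "d \<in> D" for d
      proof -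
        have eq: "a \<otimes> d = d \<otimes> a" and "a \<in> D" using Z_central Z_D a that by blast+
        then have carr: "a \<in> carrier G" "d \<in> carrier G" using that by auto
        have "inv a \<otimes> (d \<otimes> a) \<otimes> inv a = d \<otimes> inv a"
          unfolding eq[symmetric] using carr by (simp add: m_assoc[symmetric])
        then show ?thesis using carr by (simp add: m_assoc)
      qed
      then show "inv a \<in> Z" using Z_D a by (intro Z_I D.m_inv_closed) blast+
    next
      have "\<one> \<in> Z" by (intro Z_I) auto
      then show "Z \<noteq> {}" by blast
      show "Z \<subseteq> carrier G" using Z_D by auto
    qed
    fix x z assume x: "x \<in> carrier G" and z: "z \<in> Z"
    have "x \<otimes> z \<otimes> inv x \<otimes> d = d \<otimes> (x \<otimes> z \<otimes> inv x)" if d: "d \<in> D" for d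
    proof -
      have zc: "z \<in> carrier G" using Z_D[OF z] by simp
      have d': "inv x \<otimes> d \<otimes> x \<in> D" using D.inv_op_closed1[OF x d] by simp
      have "x \<otimes> z \<otimes> inv x \<otimes> d = x \<otimes> (z \<otimes> (inv x \<otimes> d \<otimes> x)) \<otimes> inv x"
        using x zc d by (simp add: m_assoc)
      also have "z \<otimes> (inv x \<otimes> d \<otimes> x) = (inv x \<otimes> d \<otimes> x) \<otimes> z" by (rule Z_central[OF z d'])
      also have "x \<otimes> \<dots> \<otimes> inv x = d \<otimes> (x \<otimes> z \<otimes> inv x)"
        using x zc d by (simp add: m_assoc) (simp add: m_assoc[symmetric])
      finally show ?thesis .
    qed
    then show "x \<otimes> z \<otimes> inv x \<in> Z" using x Z_D[OF z] by (intro Z_I D.inv_op_closed2) blast+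
  qed
  then interpret Z: normal Z G .
  have Z_comm: "a \<otimes> b = b \<otimes> a" if "a \<in> Z" "b \<in> Z" for a b
    by (rule Z_central[OF that(1) Z_D[OF that(2)]])
  obtain e :: nat where e: "e > 0" "\<And>z n. z \<in> Z \<Longrightarrow> (n::nat) > 0 \<Longrightarrow> z [^] n = \<one> \<Longrightarrow> z [^] e = \<one>"
    using noetherian_torsion_bounded[OF assms(1) Z.is_subgroup Z_comm] by blast
  \<comment> \<open>Since \<open>e\<close> annihilates all torsion of \<open>Z\<close>, the
    \<open>e\<close>-th powers form a torsion-free group.\<close>
  define A where "A = (\<lambda>z. z [^] e) ` Z"
  have "z [^] k \<in> Z" if "z \<in> Z" for z and k :: nat using that by (induction k) auto
  then have AZ: "A \<subseteq> Z" unfolding A_def by blast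
  have tf: "a = \<one>" if a: "a \<in> A" "n > 0" "a [^] n = \<one>" for a and n :: nat
  proof -
    obtain z where z: "z \<in> Z" "a = z [^] e" using a(1) unfolding A_def by (rule imageE)
    then have "z [^] (e * n) = \<one>" using a(3) by (simp add: nat_pow_pow)
    then have "z [^] e = \<one>" using e(2)[OF z(1), of "e * n"] e(1) a(2) by simp
    then show ?thesis using z by simp
  qed
  have "A \<noteq> {\<one>}"
  proof
    assume A1: "A = {\<one>}"
    let ?f = "fact (card (derived G D)) :: nat"
    have "\<exists>n::nat. n > 0 \<and> d [^] n = \<one>" if d: "d \<in> D" for d
    proof -
      have "d [^] k \<in> D" for k :: nat using d by (induction k) auto
      then have "d [^] ?f \<in> Z"
        using pow_central_of_finite_derived[OF D.is_subgroup D(2) d] by (intro Z_I)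
      then have "(d [^] ?f) [^] e \<in> A" unfolding A_def by (rule imageI)
      then have "d [^] (?f * e) = \<one>" using A1 d by (simp add: nat_pow_pow)
      then show ?thesis using e(1) by (intro exI[of _ "?f * e"]) simp
    qed
    then show False using torsion_finite_by_abelian_finite[OF assms(1) D.is_subgroup D(2)] D(1) by blast
  qed
  show thesis
  proof (rule that)
    show "A \<lhd> G" unfolding A_def by (rule powers_normal[OF Z_normal Z_comm])
    show "A \<noteq> {\<one>}" by fact
    show "a \<otimes> b = b \<otimes> a" if "a \<in> A" "b \<in> A" for a b
      by (rule Z_comm) (use AZ that in auto)
    show "a = \<one>" if "a \<in> A" "n > 0" "a [^] n = \<one>" for a and n :: nat
      by (rule tf[OF that])
  qed
qed

text \<open>Fixing the exponent \<open>m\<close> in advance lets a single \<open>N\<close> serve all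
  pairs. This suffices for a torsion unit: the finitely many support elements with nonzero trace
  have a common exponent.\<close>

lemma (in group) torsion_conjugacy_separable:
  assumes "noetherian_group G" "solvable G" "(m::nat) > 0"
  obtains N where "N \<lhd> G" "finite (carrier (G Mod N))"
    "\<And>x y k. x \<in> carrier G \<Longrightarrow> y \<in> carrier G \<Longrightarrow> k \<in> carrier G \<Longrightarrow> x [^] m = \<one> \<Longrightarrow> y [^] m = \<one> \<Longrightarrow>
       k \<otimes> x \<otimes> inv k \<otimes> inv y \<in> N \<Longrightarrow> \<exists>k'\<in>carrier G. k' \<otimes> x \<otimes> inv k' = y"
proof -
  \<comment> \<open>The membership condition says that the coset of \<open>k\<close> conjugates the
    coset of \<open>x\<close> to that of \<open>y\<close>.\<close>
  define separates where "separates N \<longleftrightarrow> (\<forall>x\<in>carrier G. \<forall>y\<in>carrier G. \<forall>k\<in>carrier G.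
    x [^] m = \<one> \<longrightarrow> y [^] m = \<one> \<longrightarrow> k \<otimes> x \<otimes> inv k \<otimes> inv y \<in> N \<longrightarrow>
    (\<exists>k'\<in>carrier G. k' \<otimes> x \<otimes> inv k' = y))" for N
  have "separates {\<one>}"
    unfolding separates_def
  proof (intro ballI impI)
    fix x y k assume *: "x \<in> carrier G" "y \<in> carrier G" "k \<in> carrier G" "k \<otimes> x \<otimes> inv k \<otimes> inv y \<in> {\<one>}"
    then have "k \<otimes> x \<otimes> inv k = y" using inv_equality[of "k \<otimes> x \<otimes> inv k" "inv y"] by simp
    then show "\<exists>k'\<in>carrier G. k' \<otimes> x \<otimes> inv k' = y" using * by blast
  qed
  then obtain N where N: "N \<in> {N. N \<lhd> G \<and> separates N}"
    "\<And>L. L \<in> {N. N \<lhd> G \<and> separates N} \<Longrightarrow> N \<subseteq> L \<Longrightarrow> L = N"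
    using noetherian_groupE[OF assms(1), of "{\<one>}" "{N. N \<lhd> G \<and> separates N}"]
      one_is_normal normal_imp_subgroup by blast
  interpret N: normal N G using N(1) by blast
  let ?Q = "G Mod N"
  interpret \<pi>: group_hom G ?Q "\<lambda>a. N #> a" by (rule N.quotient_hom)
  have "finite (carrier ?Q)"
  proof (rule ccontr)
    assume "infinite (carrier ?Q)"
    then obtain A where A: "A \<lhd> ?Q" "A \<noteq> {\<one>\<^bsub>?Q\<^esub>}"
      "\<And>a b. a \<in> A \<Longrightarrow> b \<in> A \<Longrightarrow> a \<otimes>\<^bsub>?Q\<^esub> b = b \<otimes>\<^bsub>?Q\<^esub> a"
      "\<And>a n. a \<in> A \<Longrightarrow> (n::nat) > 0 \<Longrightarrow> a [^]\<^bsub>?Q\<^esub> n = \<one>\<^bsub>?Q\<^esub> \<Longrightarrow> a = \<one>\<^bsub>?Q\<^esub>"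
      using \<pi>.H.infinite_imp_torsion_free_abelian_normal[OF
          \<pi>.noetherian_surj_image[OF N.quotient_surj assms(1)]
          \<pi>.surj_hom_imp_solvable[OF N.quotient_surj assms(2)]] by blast
    interpret A: normal A ?Q by (rule A(1))
    define P where "P = (\<lambda>a. a [^]\<^bsub>?Q\<^esub> m) ` A"
    have P: "P \<lhd> ?Q" unfolding P_def by (rule \<pi>.H.powers_normal[OF A(1) A(3)])
    \<comment> \<open>\<open>M\<close> is the preimage of the \<open>m\<close>-th powers of
      \<open>A\<close>. Once it separates, maximality gives \<open>M = N\<close>; then the
      \<open>m\<close>-th powers in \<open>A\<close> are trivial and so is the torsion-free
      \<open>A\<close>, a contradiction.\<close>
    define M where "M = {x \<in> carrier G. N #> x \<in> P}"
    have M_normal: "M \<lhd> G" unfolding M_def by (rule \<pi>.normal_vimage[OF P])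
    have "separates M"
      unfolding separates_def
    proof (intro ballI impI)
      fix x y k assume *: "x \<in> carrier G" "y \<in> carrier G" "k \<in> carrier G" "x [^] m = \<one>" "y [^] m = \<one>"
        "k \<otimes> x \<otimes> inv k \<otimes> inv y \<in> M"
      then obtain c where c: "c \<in> A" "N #> (k \<otimes> x \<otimes> inv k \<otimes> inv y) = c [^]\<^bsub>?Q\<^esub> m"
        unfolding M_def P_def by blast
      have "k \<otimes> x \<otimes> inv k = k \<otimes> x \<otimes> inv k \<otimes> inv y \<otimes> y"
        using *(1-3) by (simp add: m_assoc)
      moreover have "(N #> k) \<otimes>\<^bsub>?Q\<^esub> (N #> x) \<otimes>\<^bsub>?Q\<^esub> inv\<^bsub>?Q\<^esub> (N #> k) = N #> (k \<otimes> x \<otimes> inv k)"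
        using *(1-3) by (simp only: \<pi>.hom_mult \<pi>.hom_inv m_closed inv_closed)
      moreover have "N #> (k \<otimes> x \<otimes> inv k \<otimes> inv y \<otimes> y) = c [^]\<^bsub>?Q\<^esub> m \<otimes>\<^bsub>?Q\<^esub> (N #> y)"
        using *(1-3) by (simp only: c(2)[symmetric] \<pi>.hom_mult m_closed inv_closed)
      ultimately have eq: "(N #> k) \<otimes>\<^bsub>?Q\<^esub> (N #> x) \<otimes>\<^bsub>?Q\<^esub> inv\<^bsub>?Q\<^esub> (N #> k) = c [^]\<^bsub>?Q\<^esub> m \<otimes>\<^bsub>?Q\<^esub> (N #> y)"
        by (simp only:)
      have "\<exists>k'\<in>carrier ?Q. k' \<otimes>\<^bsub>?Q\<^esub> (N #> x) \<otimes>\<^bsub>?Q\<^esub> inv\<^bsub>?Q\<^esub> k' = N #> y"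
      proof (rule \<pi>.H.conj_of_torsion_mod_powers[OF A(1,3,4) _ _ _ _ assms(3) _ c(1) eq])
        show "(N #> x) [^]\<^bsub>?Q\<^esub> m = \<one>\<^bsub>?Q\<^esub>" "(N #> y) [^]\<^bsub>?Q\<^esub> m = \<one>\<^bsub>?Q\<^esub>"
          using \<pi>.hom_nat_pow[of x m] \<pi>.hom_nat_pow[of y m] \<pi>.hom_one * by (simp_all only:)
      qed (use * \<pi>.hom_closed in blast)+
      then obtain k' where k': "k' \<in> carrier G"
        "(N #> k') \<otimes>\<^bsub>?Q\<^esub> (N #> x) \<otimes>\<^bsub>?Q\<^esub> inv\<^bsub>?Q\<^esub> (N #> k') = N #> y"
        using N.quotient_surj by (metis (no_types, lifting) imageE)
      then have "N #> (k' \<otimes> x \<otimes> inv k') = N #> y"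
        using *(1-3) by (simp only: \<pi>.hom_mult \<pi>.hom_inv m_closed inv_closed)
      moreover have "k' \<otimes> x \<otimes> inv k' \<in> carrier G" using *(1) k'(1) by simp
      ultimately have "k' \<otimes> x \<otimes> inv k' \<otimes> inv y \<in> N" using N.quotient_eq_iff *(2) by blast
      \<comment> \<open>Conjugacy modulo \<open>M\<close> has been improved to conjugacy modulo
        \<open>N\<close>, where the separation property of \<open>N\<close> applies.\<close>
      then show "\<exists>k'\<in>carrier G. k' \<otimes> x \<otimes> inv k' = y"
        using N(1) * k'(1) unfolding separates_def by blast
    qed
    moreover have "N \<subseteq> M"
    proof
      fix x assume "x \<in> N"
      then have "x \<in> carrier G" "N #> x = \<one>\<^bsub>?Q\<^esub>"
        using N.rcos_const by auto
      then show "x \<in> M" unfolding M_def using subgroup.one_closed[OF normal_imp_subgroup[OF P]] by simp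
    qed
    ultimately have "M = N" using N(2) M_normal by blast
    have "a = \<one>\<^bsub>?Q\<^esub>" if a: "a \<in> A" for a
    proof -
      have "a [^]\<^bsub>?Q\<^esub> m \<in> carrier ?Q" using a by (intro \<pi>.H.nat_pow_closed A.mem_carrier)
      then obtain x where x: "x \<in> carrier G" "a [^]\<^bsub>?Q\<^esub> m = N #> x"
        using N.quotient_surj by (metis (no_types, lifting) imageE)
      then have "x \<in> M" using a unfolding M_def P_def by (metis (mono_tags, lifting) image_eqI mem_Collect_eq)
      then have "a [^]\<^bsub>?Q\<^esub> m = \<one>\<^bsub>?Q\<^esub>" using x \<open>M = N\<close> N.rcos_const by simp
      then show ?thesis using A(4)[OF a assms(3)] by simp
    qed
    then show False using A(2) A.one_closed by blast
  qed
  then show thesis using N(1) unfolding separates_def by (intro that[of N]) blast+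
qed

section \<open>Partial traces of powers\<close>

text \<open>The linear extension of \<open>\<chi>\<close> to the group ring. Indicators of conjugacy
  classes give partial traces and the constant \<open>1\<close> gives the augmentation, so both obey
  the same rules for products and ring maps.\<close>

definition frag_eval :: "('a \<Rightarrow> int) \<Rightarrow> ('a \<Rightarrow>\<^sub>0 int) \<Rightarrow> int" where
  "frag_eval \<chi> \<alpha> = (\<Sum>h\<in>Poly_Mapping.keys \<alpha>. Poly_Mapping.lookup \<alpha> h * \<chi> h)"

text \<open>As the coefficient of a \<open>frag_extend\<close> into the free abelian group on one
  generator, evaluation inherits the composition law \<open>frag_extend_frag_extend\<close>.\<close>

lemma frag_eval_altdef:
  "frag_eval \<chi> \<alpha> = Poly_Mapping.lookup (frag_extend (\<lambda>h. frag_cmul (\<chi> h) (frag_of ())) \<alpha>) ()"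
  by (simp add: frag_eval_def frag_extend_def lookup_sum)

lemma frag_eval_frag_of [simp]: "frag_eval \<chi> (frag_of g) = \<chi> g"
  by (simp add: frag_eval_altdef)

lemma frag_eval_frag_extend:
  "frag_eval \<chi> (frag_extend b \<alpha>) = frag_eval (\<lambda>h. frag_eval \<chi> (b h)) \<alpha>"
proof -
  have "frag_eval \<chi> (frag_extend b \<alpha>)
      = Poly_Mapping.lookup (frag_extend (\<lambda>h. frag_extend (\<lambda>h. frag_cmul (\<chi> h) (frag_of ())) (b h)) \<alpha>) ()"
    by (simp add: frag_eval_altdef frag_extend_frag_extend)
  also have "\<dots> = frag_eval (\<lambda>h. frag_eval \<chi> (b h)) \<alpha>"
    by (subst frag_extend_def) (simp add: lookup_sum frag_eval_def[of _ \<alpha>] frag_eval_altdef[of \<chi>])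
  finally show ?thesis .
qed

lemma frag_eval_mult:
  "frag_eval \<chi> (\<alpha> \<otimes>\<^bsub>integral_group_ring G\<^esub> \<beta>) = frag_eval (\<lambda>g. frag_eval (\<lambda>h. \<chi> (g \<otimes>\<^bsub>G\<^esub> h)) \<beta>) \<alpha>"
  by (simp add: integral_group_ring_def frag_eval_frag_extend)

lemma frag_eval_of_bool:
  "frag_eval (\<lambda>h. of_bool (h \<in> T)) \<alpha> = (\<Sum>h\<in>T \<inter> Poly_Mapping.keys \<alpha>. Poly_Mapping.lookup \<alpha> h)"
  unfolding frag_eval_def
  by (rule sum.mono_neutral_cong_right) (auto simp: of_bool_def)

lemma partial_trace_frag_eval:
  "partial_trace G \<alpha> g = frag_eval (\<lambda>h. of_bool (h \<in> conjugacy_class G g)) \<alpha>"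
  by (simp add: partial_trace_def frag_eval_of_bool)

lemma augmentation_frag_eval: "augmentation \<alpha> = frag_eval (\<lambda>_. 1) \<alpha>"
  by (simp add: augmentation_def frag_eval_def)

section \<open>Expansion of powers into words\<close>

definition words :: "'a set \<Rightarrow> nat \<Rightarrow> 'a list set" where
  "words S n = {w. set w \<subseteq> S \<and> length w = n}"

lemma words_0: "words S 0 = {[]}"
  by (auto simp: words_def)

text \<open>The last letter is split off because \<open>nat_pow\<close> multiplies by the new factor
  on the right.\<close>

lemma words_Suc: "words S (Suc n) = (\<lambda>(w, h). w @ [h]) ` (words S n \<times> S)"
proof (intro equalityI subsetI)
  fix w assume w: "w \<in> words S (Suc n)"
  then have "w \<noteq> []" by (auto simp: words_def)
  moreover have "set (butlast w) \<subseteq> S" "last w \<in> S"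
    using w \<open>w \<noteq> []\<close> by (auto simp: words_def dest: in_set_butlastD)
  ultimately show "w \<in> (\<lambda>(w, h). w @ [h]) ` (words S n \<times> S)"
    using w by (intro image_eqI[of _ _ "(butlast w, last w)"]) (auto simp: words_def)
qed (auto simp: words_def)

lemma finite_words: "finite S \<Longrightarrow> finite (words S n)"
  unfolding words_def by (rule finite_lists_length_eq)

text \<open>The induction needs arbitrary \<open>\<chi>\<close>: splitting off the last factor
  replaces \<open>\<chi>\<close> by a combination of its translates. The left fold brackets products
  just as \<open>nat_pow\<close> does.\<close>

lemma frag_eval_pow:
  "frag_eval \<chi> (\<alpha> [^]\<^bsub>integral_group_ring G\<^esub> (n::nat))
     = (\<Sum>w\<in>words (Poly_Mapping.keys \<alpha>) n.
          prod_list (map (Poly_Mapping.lookup \<alpha>) w) * \<chi> (foldl (\<otimes>\<^bsub>G\<^esub>) \<one>\<^bsub>G\<^esub> w))"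
proof (induction n arbitrary: \<chi>)
  case 0
  then show ?case by (simp add: words_0 nat_pow_def integral_group_ring_def)
next
  case (Suc n)
  let ?S = "Poly_Mapping.keys \<alpha>" and ?l = "Poly_Mapping.lookup \<alpha>"
  have "frag_eval \<chi> (\<alpha> [^]\<^bsub>integral_group_ring G\<^esub> Suc n)
      = frag_eval (\<lambda>g. frag_eval (\<lambda>h. \<chi> (g \<otimes>\<^bsub>G\<^esub> h)) \<alpha>) (\<alpha> [^]\<^bsub>integral_group_ring G\<^esub> n)"
    by (simp add: nat_pow_def frag_eval_mult)
  also have "\<dots> = (\<Sum>w\<in>words ?S n. \<Sum>h\<in>?S.
      prod_list (map ?l w) * (?l h * \<chi> (foldl (\<otimes>\<^bsub>G\<^esub>) \<one>\<^bsub>G\<^esub> w \<otimes>\<^bsub>G\<^esub> h)))"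
    by (simp add: Suc frag_eval_def[of _ \<alpha>] sum_distrib_left)
  also have "\<dots> = (\<Sum>(w, h)\<in>words ?S n \<times> ?S.
      prod_list (map ?l (w @ [h])) * \<chi> (foldl (\<otimes>\<^bsub>G\<^esub>) \<one>\<^bsub>G\<^esub> (w @ [h])))"
    by (simp add: sum.cartesian_product mult.assoc)
  also have "\<dots> = (\<Sum>w\<in>words ?S (Suc n).
      prod_list (map ?l w) * \<chi> (foldl (\<otimes>\<^bsub>G\<^esub>) \<one>\<^bsub>G\<^esub> w))"
    unfolding words_Suc by (subst sum.reindex) (auto simp: inj_on_def case_prod_unfold)
  finally show ?case .
qed

section \<open>Congruences modulo a prime from cyclic symmetry\<close>

lemma funpow_mult_fixed: "(f ^^ d) x = x \<Longrightarrow> (f ^^ (d * a)) x = x"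
  by (induction a) (auto simp: funpow_add)

text \<open>The periods \<open>d\<close> and \<open>p\<close> are coprime, so \<open>1\<close> is a
  combination of them. The Bezout identity is taken in the form \<open>d * a = p * b + 1\<close>
  because \<open>\<sigma>\<close> need not be invertible.\<close>

lemma fixed_of_prime_period:
  assumes "prime p" "(\<sigma> ^^ p) x = x" "(\<sigma> ^^ d) x = x" "0 < d" "d < p"
  shows "\<sigma> x = x"
proof -
  have "coprime d p"
    using assms by (metis coprime_commute dvd_imp_le not_less prime_imp_coprime_nat)
  then obtain a b where "d * a = p * b + 1"
    using bezout_nat[of d p] assms(4) by (metis coprime_imp_gcd_eq_1 less_irrefl)
  then have "\<sigma> ((\<sigma> ^^ (p * b)) x) = x" using funpow_mult_fixed[OF assms(3), of a] by simp
  then show ?thesis using funpow_mult_fixed[OF assms(2)] by simp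
qed

text \<open>Orbit counting for a cyclic group of prime order: an orbit that is not a fixed point has
  exactly \<open>p\<close> elements and contributes \<open>p\<close> times a value of
  \<open>f\<close>. The induction removes one such orbit at a time.\<close>

lemma sum_cong_sum_fixed_points:
  fixes f :: "'a \<Rightarrow> int"
  assumes "finite X" "prime p" "\<And>x. x \<in> X \<Longrightarrow> \<sigma> x \<in> X" "\<And>x. x \<in> X \<Longrightarrow> (\<sigma> ^^ p) x = x"
    and "\<And>x. x \<in> X \<Longrightarrow> f (\<sigma> x) = f x"
  shows "[sum f X = sum f {x \<in> X. \<sigma> x = x}] (mod int p)"
  using assms(1,3-5)
proof (induction X rule: finite_psubset_induct)
  case (psubset X)
  show ?case
  proof (cases "\<forall>x\<in>X. \<sigma> x = x")
    case True
    then have "{x \<in> X. \<sigma> x = x} = X" by blast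
    then show ?thesis by simp
  next
    case False
    then obtain x where x: "x \<in> X" "\<sigma> x \<noteq> x" by blast
    have p0: "p > 0" using assms(2) prime_gt_0_nat by blast
    define Orb where "Orb = (\<lambda>i. (\<sigma> ^^ i) x) ` {..<p}"
    have pow_X: "(\<sigma> ^^ i) x \<in> X" "f ((\<sigma> ^^ i) x) = f x" for i
      by (induction i) (use psubset.prems x in auto)
    have orbit_return: "(\<sigma> ^^ (p - i)) ((\<sigma> ^^ i) x) = x" if "i < p" for i
      using that psubset.prems(2)[OF x(1)] by (simp flip: funpow_add[THEN fun_cong, simplified])
    have Orb_closed: "\<sigma> y \<in> Orb" if y: "y \<in> Orb" for y
    proof -
      obtain i where i: "i < p" "y = (\<sigma> ^^ i) x" using y unfolding Orb_def by auto
      have "\<sigma> y = (\<sigma> ^^ (Suc i mod p)) x"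
      proof (cases "Suc i = p")
        case True
        then show ?thesis using i psubset.prems(2)[OF x(1)] by auto
      next
        case False
        then show ?thesis using i by simp
      qed
      then show ?thesis using p0 unfolding Orb_def by simp
    qed
    have Orb_pow: "(\<sigma> ^^ i) y \<in> Orb" if "y \<in> Orb" for y i
      using that by (induction i) (auto intro: Orb_closed)
    have inj: "inj_on (\<lambda>i. (\<sigma> ^^ i) x) {..<p}"
    proof (rule linorder_inj_onI')
      fix i j assume ij: "i \<in> {..<p}" "j \<in> {..<p}" "i < j"
      show "(\<sigma> ^^ i) x \<noteq> (\<sigma> ^^ j) x"
      proof
        assume eq: "(\<sigma> ^^ i) x = (\<sigma> ^^ j) x"
        \<comment> \<open>Applying \<open>\<sigma> ^^ (p - i)\<close> to both sides of the
          coincidence completes a period on the left and shows that \<open>j - i\<close> is a period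
          of \<open>x\<close>.\<close>
        have "(\<sigma> ^^ (p - i)) ((\<sigma> ^^ j) x) = (\<sigma> ^^ (p - i + j)) x" by (simp add: funpow_add)
        also have "p - i + j = (j - i) + p" using ij by simp
        also have "(\<sigma> ^^ ((j - i) + p)) x = (\<sigma> ^^ (j - i)) x"
          using psubset.prems(2)[OF x(1)] by (simp only: funpow_add o_apply)
        finally have "(\<sigma> ^^ (j - i)) x = x" using orbit_return[of i] ij eq by simp
        moreover have "0 < j - i" "j - i < p" using ij by auto
        ultimately show False
          using fixed_of_prime_period[OF assms(2) psubset.prems(2)[OF x(1)], of "j - i"] x(2) by simp
      qed
    qed
    have Orb_sum: "sum f Orb = int p * f x"
      unfolding Orb_def using inj by (subst sum.reindex) (simp_all add: pow_X)
    \<comment> \<open>A fixed point in the orbit would remain fixed under all iterates, one of which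
      returns to the non-fixed \<open>x\<close>.\<close>
    have Orb_fixed: "\<sigma> y \<noteq> y" if y: "y \<in> Orb" for y
    proof
      assume eq: "\<sigma> y = y"
      obtain i where i: "i < p" "y = (\<sigma> ^^ i) x" using y unfolding Orb_def by auto
      have "(\<sigma> ^^ k) y = y" for k by (induction k) (simp_all add: eq)
      then have "x = y" using orbit_return[OF i(1)] i(2) by metis
      then show False using eq x(2) by simp
    qed
    have "Orb \<subseteq> X" using pow_X unfolding Orb_def by blast
    have "x \<in> Orb" unfolding Orb_def using p0 by (intro image_eqI[of _ _ 0]) auto
    have "[sum f (X - Orb) = sum f {y \<in> X - Orb. \<sigma> y = y}] (mod int p)"
    proof (rule psubset.IH)
      show "X - Orb \<subset> X" using \<open>x \<in> Orb\<close> x(1) by blast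
      fix y assume y: "y \<in> X - Orb"
      \<comment> \<open>The complement is invariant as well: the remaining \<open>p - 1\<close>
        steps would bring \<open>y\<close> back into \<open>Orb\<close>.\<close>
      have "\<sigma> y \<notin> Orb"
      proof
        assume "\<sigma> y \<in> Orb"
        then have "(\<sigma> ^^ (p - 1)) (\<sigma> y) \<in> Orb" by (rule Orb_pow)
        moreover have "(\<sigma> ^^ (p - 1)) (\<sigma> y) = (\<sigma> ^^ p) y"
          using p0 funpow_Suc_right[of "p - 1" \<sigma>] by simp
        ultimately show False using y psubset.prems(2) by auto
      qed
      then show "\<sigma> y \<in> X - Orb" using y psubset.prems(1) by blast
    qed (use psubset.prems in auto)
    moreover have "sum f X = sum f (X - Orb) + int p * f x"
      using sum.subset_diff[OF \<open>Orb \<subseteq> X\<close> psubset.hyps(1), of f] by (simp only: Orb_sum)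
    moreover have "{y \<in> X. \<sigma> y = y} = {y \<in> X - Orb. \<sigma> y = y}" using Orb_fixed by blast
    ultimately show ?thesis by (simp add: cong_def)
  qed
qed

lemma fermat_int:
  fixes a :: int
  assumes "prime p"
  shows "[a ^ p = a] (mod int p)"
proof -
  \<comment> \<open>A natural representative gives access to \<open>fermat_theorem\<close>.\<close>
  define b where "b = nat (a mod int p)"
  have p0: "p > 0" using assms prime_gt_0_nat by blast
  have ab: "[a = int b] (mod int p)" using p0 by (simp add: b_def cong_def)
  have "[b ^ p = b] (mod p)"
  proof (cases "p dvd b")
    case True
    then show ?thesis using p0 by (simp add: cong_def dvd_imp_mod_0 dvd_power_le mod_eq_0_iff_dvd dvd_trans[OF _ dvd_power])
  next
    case False
    then have "[b * b ^ (p - 1) = b * 1] (mod p)"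
      using assms by (intro cong_scalar_left fermat_theorem)
    then show ?thesis using p0 by (simp add: power_eq_if)
  qed
  then have "[int b ^ p = int b] (mod int p)" by (metis cong_int_iff of_nat_power)
  with cong_pow[OF ab, of p] have "[a ^ p = int b] (mod int p)" by (rule cong_trans)
  then show ?thesis using cong_sym[OF ab] by (rule cong_trans)
qed

section \<open>Conjugacy classes and products of words\<close>

context group
begin

lemma conjugacy_class_iff: "y \<in> conjugacy_class G x \<longleftrightarrow> (\<exists>k\<in>carrier G. k \<otimes> x \<otimes> inv k = y)"
  by (auto simp: conjugacy_class_def)

lemma conjugacy_class_closed: "x \<in> carrier G \<Longrightarrow> y \<in> conjugacy_class G x \<Longrightarrow> y \<in> carrier G"
  by (auto simp: conjugacy_class_def)

lemma conjugacy_class_refl: "x \<in> carrier G \<Longrightarrow> x \<in> conjugacy_class G x"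
  unfolding conjugacy_class_iff by (intro bexI[of _ \<one>]) auto

lemma conjugacy_class_trans:
  assumes "x \<in> carrier G" "y \<in> conjugacy_class G x" "z \<in> conjugacy_class G y"
  shows "z \<in> conjugacy_class G x"
proof -
  obtain k l where "k \<in> carrier G" "k \<otimes> x \<otimes> inv k = y" "l \<in> carrier G" "l \<otimes> y \<otimes> inv l = z"
    using assms by (auto simp: conjugacy_class_iff)
  then show ?thesis
    using conj_by_mult[of l k x] assms(1) unfolding conjugacy_class_iff
    by (intro bexI[of _ "l \<otimes> k"]) auto
qed

lemma conjugacy_class_sym:
  assumes "x \<in> carrier G" "y \<in> conjugacy_class G x"
  shows "x \<in> conjugacy_class G y"
proof -
  obtain k where k: "k \<in> carrier G" "k \<otimes> x \<otimes> inv k = y"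
    using assms by (auto simp: conjugacy_class_iff)
  then have "inv k \<otimes> y \<otimes> inv (inv k) = x"
    using conj_by_mult[of "inv k" k x] assms(1) by simp
  then show ?thesis using k(1) unfolding conjugacy_class_iff by blast
qed

lemma conjugacy_class_eq:
  assumes "x \<in> carrier G" "y \<in> conjugacy_class G x"
  shows "conjugacy_class G y = conjugacy_class G x"
proof (intro equalityI subsetI)
  fix z assume "z \<in> conjugacy_class G y"
  then show "z \<in> conjugacy_class G x" by (rule conjugacy_class_trans[OF assms])
next
  fix z assume "z \<in> conjugacy_class G x"
  then show "z \<in> conjugacy_class G y"
    by (rule conjugacy_class_trans[OF conjugacy_class_closed[OF assms] conjugacy_class_sym[OF assms]])
qed

lemma conjugacy_class_pow:
  fixes n :: nat
  assumes "x \<in> carrier G" "y \<in> conjugacy_class G x"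
  shows "y [^] n \<in> conjugacy_class G (x [^] n)"
proof -
  obtain k where "k \<in> carrier G" "k \<otimes> x \<otimes> inv k = y"
    using assms(2) by (auto simp: conjugacy_class_iff)
  then show ?thesis
    using conj_nat_pow[of k x n] assms(1) unfolding conjugacy_class_iff by auto
qed

lemma foldl_mult_closed:
  assumes "a \<in> carrier G" "set w \<subseteq> carrier G"
  shows "foldl (\<otimes>) a w \<in> carrier G"
  using assms by (induction w arbitrary: a) auto

lemma foldl_mult_eq:
  assumes "a \<in> carrier G" "set w \<subseteq> carrier G"
  shows "foldl (\<otimes>) a w = a \<otimes> foldl (\<otimes>) \<one> w"
  using assms
proof (induction w arbitrary: a)
  case (Cons h w)
  have "foldl (\<otimes>) (a \<otimes> h) w = a \<otimes> h \<otimes> foldl (\<otimes>) \<one> w"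
    "foldl (\<otimes>) h w = h \<otimes> foldl (\<otimes>) \<one> w"
    using Cons.IH[of "a \<otimes> h"] Cons.IH[of h] Cons.prems by simp_all
  then show ?case using Cons.prems foldl_mult_closed[of \<one> w] by (simp add: m_assoc)
qed simp

lemma foldl_mult_replicate:
  assumes "h \<in> carrier G"
  shows "foldl (\<otimes>) \<one> (replicate n h) = h [^] n"
proof -
  have "foldl (\<otimes>) a (replicate n h) = a \<otimes> h [^] n" if "a \<in> carrier G" for a
    using that
  proof (induction n arbitrary: a)
    case (Suc n)
    then have "foldl (\<otimes>) a (replicate (Suc n) h) = a \<otimes> h \<otimes> h [^] n" using assms by simp
    also have "\<dots> = a \<otimes> h [^] Suc n"
      using assms Suc.prems nat_pow_Suc2[OF assms, of n] by (simp only: m_assoc nat_pow_closed)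
    finally show ?case .
  qed simp
  from this[of \<one>] show ?thesis using assms by simp
qed

text \<open>Moving the first letter \<open>h\<close> to the end conjugates the product by
  \<open>inv h\<close>.\<close>

lemma foldl_mult_rotate1:
  assumes "set w \<subseteq> carrier G"
  shows "foldl (\<otimes>) \<one> w \<in> conjugacy_class G (foldl (\<otimes>) \<one> (rotate1 w))"
proof (cases w)
  case Nil
  then show ?thesis using conjugacy_class_refl[of \<one>] by simp
next
  case (Cons h v)
  let ?v = "foldl (\<otimes>) \<one> v"
  have c: "h \<in> carrier G" "?v \<in> carrier G" using assms Cons foldl_mult_closed[of \<one> v] by auto
  have "foldl (\<otimes>) \<one> w = h \<otimes> ?v"
    using assms Cons foldl_mult_eq[of h v] by simp
  moreover have "foldl (\<otimes>) \<one> (rotate1 w) = ?v \<otimes> h" using Cons by simp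
  moreover have "h \<otimes> (?v \<otimes> h) \<otimes> inv h = h \<otimes> ?v" using c by (simp add: m_assoc)
  ultimately show ?thesis using c(1) unfolding conjugacy_class_iff by auto
qed

text \<open>Rotation preserves the coefficient of a word and the class of its product, so modulo
  \<open>p\<close> only constant words survive. The word of \<open>p\<close> letters
  \<open>h\<close> has coefficient \<open>\<alpha>(h)\<close> to the power \<open>p\<close>, which
  is \<open>\<alpha>(h)\<close> modulo \<open>p\<close> by Fermat.\<close>

lemma partial_trace_prime_pow:
  assumes "Poly_Mapping.keys \<alpha> \<subseteq> carrier G" "prime p" "g \<in> carrier G"
  shows "[partial_trace G (\<alpha> [^]\<^bsub>integral_group_ring G\<^esub> p) g
     = (\<Sum>h\<in>{h. h [^] p \<in> conjugacy_class G g} \<inter> Poly_Mapping.keys \<alpha>. Poly_Mapping.lookup \<alpha> h)] (mod int p)"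
proof -
  let ?S = "Poly_Mapping.keys \<alpha>" and ?l = "Poly_Mapping.lookup \<alpha>"
  let ?\<chi> = "\<lambda>h. of_bool (h \<in> conjugacy_class G g) :: int"
  let ?f = "\<lambda>w. prod_list (map ?l w) * ?\<chi> (foldl (\<otimes>) \<one> w)"
  have p0: "p > 0" using assms(2) prime_gt_0_nat by blast
  have rot: "?f (rotate1 w) = ?f w" if "w \<in> words ?S p" for w
  proof -
    have w: "set w \<subseteq> carrier G" using that assms(1) by (auto simp: words_def)
    have "prod_list (map ?l (rotate1 w)) = prod_list (map ?l w)" by (cases w) auto
    moreover have "foldl (\<otimes>) \<one> (rotate1 w) \<in> conjugacy_class G g \<longleftrightarrow> foldl (\<otimes>) \<one> w \<in> conjugacy_class G g"
    proof
      assume "foldl (\<otimes>) \<one> (rotate1 w) \<in> conjugacy_class G g"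
      then show "foldl (\<otimes>) \<one> w \<in> conjugacy_class G g"
        using foldl_mult_rotate1[OF w] by (rule conjugacy_class_trans[OF assms(3)])
    next
      assume "foldl (\<otimes>) \<one> w \<in> conjugacy_class G g"
      moreover have "foldl (\<otimes>) \<one> (rotate1 w) \<in> carrier G" using w by (intro foldl_mult_closed) auto
      then have "foldl (\<otimes>) \<one> (rotate1 w) \<in> conjugacy_class G (foldl (\<otimes>) \<one> w)"
        using foldl_mult_rotate1[OF w] by (rule conjugacy_class_sym)
      ultimately show "foldl (\<otimes>) \<one> (rotate1 w) \<in> conjugacy_class G g"
        by (rule conjugacy_class_trans[OF assms(3)])
    qed
    ultimately show ?thesis by simp
  qed
  have fixed: "{w \<in> words ?S p. rotate1 w = w} = replicate p ` ?S"
  proof (intro equalityI subsetI)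
    fix w assume w: "w \<in> {w \<in> words ?S p. rotate1 w = w}"
    then have "w \<noteq> []" using p0 by (auto simp: words_def)
    then obtain h where "set w = {h}"
      using w rotate1_fixpoint_card[of w] card_1_singletonE by blast
    then have "w = replicate p h" using w replicate_eqI[of w p h] by (auto simp: words_def)
    then show "w \<in> replicate p ` ?S" using w \<open>set w = {h}\<close> by (auto simp: words_def)
  qed (auto simp: words_def)
  have "partial_trace G (\<alpha> [^]\<^bsub>integral_group_ring G\<^esub> p) g = sum ?f (words ?S p)"
    by (simp add: partial_trace_frag_eval frag_eval_pow)
  also have "[\<dots> = sum ?f {w \<in> words ?S p. rotate1 w = w}] (mod int p)"
  proof (rule sum_cong_sum_fixed_points[where f = ?f and \<sigma> = rotate1, OF _ assms(2)])
    show "?f (rotate1 w) = ?f w" if "w \<in> words ?S p" for w by (rule rot[OF that])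
    show "(rotate1 ^^ p) w = w" if "w \<in> words ?S p" for w
      using that rotate_id[of p w] by (simp add: words_def rotate_def)
  qed (auto simp: finite_words, auto simp: words_def)
  also have "sum ?f {w \<in> words ?S p. rotate1 w = w} = (\<Sum>h\<in>?S. ?l h ^ p * ?\<chi> (h [^] p))"
    unfolding fixed using p0 assms(1)
    by (subst sum.reindex) (auto simp: inj_on_def foldl_mult_replicate replicate_eq_replicate subset_iff intro!: sum.cong)
  also have "[\<dots> = (\<Sum>h\<in>?S. ?l h * ?\<chi> (h [^] p))] (mod int p)"
    by (intro cong_sum cong_mult fermat_int[OF assms(2)] cong_refl)
  also have "(\<Sum>h\<in>?S. ?l h * ?\<chi> (h [^] p)) = (\<Sum>h\<in>{h. h [^] p \<in> conjugacy_class G g} \<inter> ?S. ?l h)"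
    by (rule sum.mono_neutral_cong_right) (auto simp: of_bool_def)
  finally show ?thesis .
qed

text \<open>On the support, \<open>T\<close> is a union of conjugacy classes, so the sum splits into
  partial traces. Besides primes, \<open>d = 0\<close> is a useful choice: divisibility by
  \<open>0\<close> expresses vanishing.\<close>

lemma dvd_sum_partial_traces:
  assumes "Poly_Mapping.keys \<alpha> \<subseteq> carrier G"
    and closed: "\<And>x y. x \<in> T \<inter> Poly_Mapping.keys \<alpha> \<Longrightarrow> y \<in> conjugacy_class G x \<Longrightarrow> y \<in> T"
    and dvd: "\<And>x. x \<in> T \<inter> Poly_Mapping.keys \<alpha> \<Longrightarrow> d dvd partial_trace G \<alpha> x"
  shows "d dvd (\<Sum>h\<in>T \<inter> Poly_Mapping.keys \<alpha>. Poly_Mapping.lookup \<alpha> h)"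
proof -
  let ?S = "T \<inter> Poly_Mapping.keys \<alpha>" and ?l = "Poly_Mapping.lookup \<alpha>"
  have "sum ?l ?S = (\<Sum>c\<in>conjugacy_class G ` ?S. sum ?l {h \<in> ?S. conjugacy_class G h = c})"
    by (rule sum.group[symmetric]) auto
  also have "d dvd \<dots>"
  proof (rule dvd_sum)
    fix c assume "c \<in> conjugacy_class G ` ?S"
    then obtain x where x: "x \<in> ?S" "c = conjugacy_class G x" by blast
    have "{h \<in> ?S. conjugacy_class G h = c} = conjugacy_class G x \<inter> Poly_Mapping.keys \<alpha>"
    proof (intro equalityI subsetI)
      fix h assume "h \<in> {h \<in> ?S. conjugacy_class G h = c}"
      then show "h \<in> conjugacy_class G x \<inter> Poly_Mapping.keys \<alpha>"
        using x assms(1) conjugacy_class_refl[of h] by auto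
    next
      fix h assume "h \<in> conjugacy_class G x \<inter> Poly_Mapping.keys \<alpha>"
      then show "h \<in> {h \<in> ?S. conjugacy_class G h = c}"
        using x assms(1) closed[OF x(1)] conjugacy_class_eq[of x h] by auto
    qed
    then show "d dvd sum ?l {h \<in> ?S. conjugacy_class G h = c}"
      using dvd[OF x(1)] by (simp add: partial_trace_def)
  qed
  finally show ?thesis .
qed

end

section \<open>Nonzero partial traces occur only at torsion elements\<close>

context group
begin

lemma keys_group_ring_pow:
  fixes n :: nat
  assumes "Poly_Mapping.keys \<alpha> \<subseteq> carrier G"
  shows "Poly_Mapping.keys (\<alpha> [^]\<^bsub>integral_group_ring G\<^esub> n) \<subseteq> carrier G"
proof -
  interpret R: ring "integral_group_ring G" by (rule ring_integral_group_ring[OF is_group])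
  show ?thesis
    using assms R.nat_pow_closed[of \<alpha> n] by (simp add: integral_group_ring_def)
qed

text \<open>If \<open>p\<close> divided the trace of \<alpha> at every supported root, it would
  divide their sum, which \<open>partial_trace_prime_pow\<close> identifies with the given trace
  modulo \<open>p\<close>.\<close>

lemma partial_trace_root:
  assumes "Poly_Mapping.keys \<alpha> \<subseteq> carrier G" "prime p" "g \<in> carrier G"
    and "\<not> int p dvd partial_trace G (\<alpha> [^]\<^bsub>integral_group_ring G\<^esub> p) g"
  obtains h where "h \<in> carrier G" "h [^] p \<in> conjugacy_class G g" "\<not> int p dvd partial_trace G \<alpha> h"
proof -
  let ?T = "{h. h [^] p \<in> conjugacy_class G g}"
  have "\<not> int p dvd (\<Sum>h\<in>?T \<inter> Poly_Mapping.keys \<alpha>. Poly_Mapping.lookup \<alpha> h)"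
    using partial_trace_prime_pow[OF assms(1-3)] assms(4) cong_dvd_iff by blast
  moreover have "y \<in> ?T" if "x \<in> ?T \<inter> Poly_Mapping.keys \<alpha>" "y \<in> conjugacy_class G x" for x y
  proof -
    have "x \<in> carrier G" "x [^] p \<in> conjugacy_class G g" using that(1) assms(1) by auto
    then show ?thesis
      using conjugacy_class_trans[OF assms(3) _ conjugacy_class_pow[OF _ that(2)]] by simp
  qed
  ultimately obtain x where "x \<in> ?T \<inter> Poly_Mapping.keys \<alpha>" "\<not> int p dvd partial_trace G \<alpha> x"
    using dvd_sum_partial_traces[OF assms(1), of ?T "int p"] by blast
  then show thesis using assms(1) by (intro that[of x]) auto
qed

text \<open>One root is extracted for the unit \<open>\<alpha>\<close> raised to
  \<open>p ^ k\<close>, and the induction hypothesis continues from that root, which is why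
  \<open>g\<close> varies.\<close>

lemma partial_trace_prime_power_root:
  assumes "Poly_Mapping.keys \<alpha> \<subseteq> carrier G" "prime p" "g \<in> carrier G"
    and "\<not> int p dvd partial_trace G (\<alpha> [^]\<^bsub>integral_group_ring G\<^esub> (p ^ k)) g"
  shows "\<exists>h\<in>carrier G. h [^] (p ^ k) \<in> conjugacy_class G g \<and> \<not> int p dvd partial_trace G \<alpha> h"
  using assms(3,4)
proof (induction k arbitrary: g)
  case 0
  interpret R: ring "integral_group_ring G" by (rule ring_integral_group_ring[OF is_group])
  have "\<alpha> \<in> carrier (integral_group_ring G)" using assms(1) by (simp add: integral_group_ring_def)
  then have "\<alpha> [^]\<^bsub>integral_group_ring G\<^esub> (p ^ 0) = \<alpha>" using R.nat_pow_eone[of \<alpha>] by simp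
  then show ?case using 0 conjugacy_class_refl[OF 0(1)] by (intro bexI[of _ g]) auto
next
  case (Suc k)
  interpret R: ring "integral_group_ring G" by (rule ring_integral_group_ring[OF is_group])
  let ?\<beta> = "\<alpha> [^]\<^bsub>integral_group_ring G\<^esub> (p ^ k)"
  have "\<alpha> \<in> carrier (integral_group_ring G)" using assms(1) by (simp add: integral_group_ring_def)
  then have "?\<beta> [^]\<^bsub>integral_group_ring G\<^esub> p = \<alpha> [^]\<^bsub>integral_group_ring G\<^esub> (p ^ Suc k)"
    by (simp add: R.nat_pow_pow mult.commute)
  then have "\<not> int p dvd partial_trace G (?\<beta> [^]\<^bsub>integral_group_ring G\<^esub> p) g" using Suc.prems(2) by simp
  then obtain h' where h': "h' \<in> carrier G" "h' [^] p \<in> conjugacy_class G g" "\<not> int p dvd partial_trace G ?\<beta> h'"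
    by (rule partial_trace_root[OF keys_group_ring_pow[OF assms(1)] assms(2) Suc.prems(1)])
  then obtain h where h: "h \<in> carrier G" "h [^] (p ^ k) \<in> conjugacy_class G h'" "\<not> int p dvd partial_trace G \<alpha> h"
    using Suc.IH by blast
  have "(h [^] (p ^ k)) [^] p \<in> conjugacy_class G (h' [^] p)"
    by (rule conjugacy_class_pow[OF h'(1) h(2)])
  then have "(h [^] (p ^ k)) [^] p \<in> conjugacy_class G g"
    by (rule conjugacy_class_trans[OF Suc.prems(1) h'(2)])
  moreover have "(h [^] (p ^ k)) [^] p = h [^] (p ^ Suc k)"
    using h(1) by (simp add: nat_pow_pow mult.commute)
  ultimately show ?case using h(1,3) by auto
qed

text \<open>Roots up to conjugacy can be taken forever inside \<open>R\<close>, whose elements fall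
  into finitely many classes because each class meets \<open>S\<close>. In the application
  \<open>S\<close> is the support and \<open>R\<close> collects the elements whose trace is prime to
  \<open>p\<close>.\<close>

lemma torsion_of_iterated_power_roots:
  assumes "noetherian_group G" "q \<ge> 2" "finite S" "S \<subseteq> carrier G" "R \<subseteq> carrier G" "g \<in> R"
    and meets: "\<And>h. h \<in> R \<Longrightarrow> \<exists>x\<in>S. x \<in> conjugacy_class G h"
    and root: "\<And>h. h \<in> R \<Longrightarrow> \<exists>h'\<in>R. h' [^] (q::nat) \<in> conjugacy_class G h"
  shows "\<exists>m::nat. m > 0 \<and> g [^] m = \<one>"
proof -
  obtain r where r: "\<And>h. h \<in> R \<Longrightarrow> r h \<in> R \<and> r h [^] q \<in> conjugacy_class G h"
    using root by metis
  obtain rep where rep: "\<And>h. h \<in> R \<Longrightarrow> rep h \<in> S \<and> rep h \<in> conjugacy_class G h"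
    using meets by metis
  \<comment> \<open>The chain starts at \<open>g\<close>, and the \<open>q\<close>-th power of each
    term is conjugate to the preceding one.\<close>
  define s where "s i = (r ^^ i) g" for i
  have sR: "s i \<in> R" for i unfolding s_def using assms(6) r by (induction i) auto
  then have sG: "s i \<in> carrier G" for i using assms(5) by blast
  have s_pow: "s (i + d) [^] (q ^ d) \<in> conjugacy_class G (s i)" for i d
  proof (induction d)
    case 0
    then show ?case using sG conjugacy_class_refl by simp
  next
    case (Suc d)
    have "s (i + Suc d) [^] q \<in> conjugacy_class G (s (i + d))"
      using r[OF sR[of "i + d"]] by (simp add: s_def)
    then have "(s (i + Suc d) [^] q) [^] (q ^ d) \<in> conjugacy_class G (s (i + d) [^] (q ^ d))"
      by (rule conjugacy_class_pow[OF sG])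
    then have "(s (i + Suc d) [^] q) [^] (q ^ d) \<in> conjugacy_class G (s i)"
      by (rule conjugacy_class_trans[OF sG Suc])
    then show ?case using sG[of "i + Suc d"] by (simp add: nat_pow_pow)
  qed
  have "\<not> inj (\<lambda>i. rep (s i))"
  proof
    assume "inj (\<lambda>i. rep (s i))"
    moreover have "range (\<lambda>i. rep (s i)) \<subseteq> S" using rep sR by blast
    ultimately show False using assms(3) finite_imageD finite_subset infinite_UNIV_nat by blast
  qed
  then obtain i j where ij: "i < j" "rep (s i) = rep (s j)"
    by (metis (no_types, lifting) linorder_injI)
  define d where "d = j - i"
  have j: "j = i + d" "d > 0" using ij(1) by (auto simp: d_def)
  have "conjugacy_class G (s i) = conjugacy_class G (s j)"
    using conjugacy_class_eq[OF sG] rep[OF sR[of i]] rep[OF sR[of j]] ij(2) by metis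
  then have "s j [^] (q ^ d) \<in> conjugacy_class G (s j)" using s_pow[of i d] j(1) by simp
  then obtain k where k: "k \<in> carrier G" "k \<otimes> s j \<otimes> inv k = s j [^] (q ^ d)"
    unfolding conjugacy_class_iff by blast
  have "q ^ d \<ge> 2" using self_le_power[of q d] assms(2) j(2) by linarith
  then obtain n :: nat where n: "n > 0" "s j [^] n = \<one>"
    using noetherian_conj_to_power[OF assms(1) k(1) sG k(2)] by blast
  have s0: "s 0 = g" by (simp add: s_def)
  \<comment> \<open>Torsion travels down the chain: \<open>g\<close> is conjugate to a power of the
    torsion element \<open>s j\<close>.\<close>
  have "g \<in> conjugacy_class G (s j [^] (q ^ j))"
    by (rule conjugacy_class_sym) (use s_pow[of 0 j] sG[of 0] s0 in simp_all)
  then have "g [^] n \<in> conjugacy_class G ((s j [^] (q ^ j)) [^] n)"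
    by (rule conjugacy_class_pow[OF nat_pow_closed[OF sG]])
  also have "(s j [^] (q ^ j)) [^] n = (s j [^] n) [^] (q ^ j)"
    using sG[of j] by (simp add: nat_pow_pow mult.commute)
  finally have "g [^] n = \<one>" using n(2) by (auto simp: conjugacy_class_iff)
  then show ?thesis using n(1) by blast
qed

lemma torsion_of_partial_trace_nonzero:
  assumes "noetherian_group G" "Poly_Mapping.keys \<alpha> \<subseteq> carrier G" "g \<in> carrier G"
    and "\<alpha> [^]\<^bsub>integral_group_ring G\<^esub> (n::nat) = \<one>\<^bsub>integral_group_ring G\<^esub>" "n > 0"
    and "partial_trace G \<alpha> g \<noteq> 0"
  shows "\<exists>m::nat. m > 0 \<and> g [^] m = \<one>"
proof -
  interpret R: ring "integral_group_ring G" by (rule ring_integral_group_ring[OF is_group])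
  have \<alpha>: "\<alpha> \<in> carrier (integral_group_ring G)" using assms(2) by (simp add: integral_group_ring_def)
  \<comment> \<open>Being larger than \<open>n\<close> makes \<open>p\<close> coprime to
    \<open>n\<close>; being larger than the absolute value of the trace keeps the trace nonzero
    modulo \<open>p\<close>.\<close>
  obtain p where p: "prime p" "p > n + nat \<bar>partial_trace G \<alpha> g\<bar>" using bigger_prime by blast
  have "\<not> p dvd n" using p(2) assms(5) by (auto dest: dvd_imp_le)
  then have "coprime p n" using p(1) prime_imp_coprime by blast
  \<comment> \<open>By Euler's theorem \<open>q\<close> is congruent to \<open>1\<close> modulo
    \<open>n\<close>, so the \<open>q\<close>-th power of \<alpha> is \<alpha>.\<close>
  define q where "q = p ^ totient n"
  have "[q = 1] (mod n)" unfolding q_def by (rule euler_theorem[OF \<open>coprime p n\<close>])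
  moreover have "q \<ge> 2"
  proof -
    have "totient n > 0" using assms(5) by simp
    then have "q \<ge> p" unfolding q_def using p(1) prime_ge_1_nat by (intro self_le_power) auto
    then show ?thesis using prime_ge_2_nat[OF p(1)] by linarith
  qed
  ultimately obtain j where j: "q = n * j + 1"
    using cong_to_1'_nat by (metis Suc_eq_plus1 add.commute mult.commute One_nat_def not_numeral_le_zero plus_1_eq_Suc)
  have \<alpha>q: "\<alpha> [^]\<^bsub>integral_group_ring G\<^esub> q = \<alpha>"
  proof -
    have "\<alpha> [^]\<^bsub>integral_group_ring G\<^esub> (n * j) = \<one>\<^bsub>integral_group_ring G\<^esub>"
      using R.nat_pow_pow[OF \<alpha>, of n j] assms(4) by (simp add: R.nat_pow_one)
    then show ?thesis unfolding j using \<alpha> by simp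
  qed
  \<comment> \<open>Indivisibility by \<open>p\<close>, rather than being nonzero, is the property
    of traces that passes to roots.\<close>
  let ?R = "{h \<in> carrier G. \<not> int p dvd partial_trace G \<alpha> h}"
  show ?thesis
  proof (rule torsion_of_iterated_power_roots[OF assms(1) \<open>q \<ge> 2\<close> finite_keys assms(2), of ?R])
    have "\<not> int p dvd partial_trace G \<alpha> g"
    proof
      assume "int p dvd partial_trace G \<alpha> g"
      then have "\<bar>int p\<bar> \<le> \<bar>partial_trace G \<alpha> g\<bar>" using assms(6) dvd_imp_le_int by blast
      then show False using p(2) by linarith
    qed
    then show "g \<in> ?R" using assms(3) by blast
    fix h assume h: "h \<in> ?R"
    have "conjugacy_class G h \<inter> Poly_Mapping.keys \<alpha> \<noteq> {}"
    proof
      assume "conjugacy_class G h \<inter> Poly_Mapping.keys \<alpha> = {}"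
      then have "partial_trace G \<alpha> h = 0" by (simp add: partial_trace_def)
      then show False using h by simp
    qed
    then show "\<exists>x\<in>Poly_Mapping.keys \<alpha>. x \<in> conjugacy_class G h" by blast
    have "\<not> int p dvd partial_trace G (\<alpha> [^]\<^bsub>integral_group_ring G\<^esub> (p ^ totient n)) h"
      using h \<alpha>q by (simp add: q_def)
    then show "\<exists>h'\<in>?R. h' [^] q \<in> conjugacy_class G h"
      using partial_trace_prime_power_root[OF assms(2) p(1), of h "totient n"] h
      unfolding q_def by blast
  qed auto
qed

end

section \<open>Passing to quotients\<close>

definition group_ring_map :: "('a \<Rightarrow> 'b) \<Rightarrow> ('a \<Rightarrow>\<^sub>0 int) \<Rightarrow> ('b \<Rightarrow>\<^sub>0 int)" where
  "group_ring_map f = frag_extend (\<lambda>g. frag_of (f g))"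

lemma frag_eval_group_ring_map: "frag_eval \<chi> (group_ring_map f \<alpha>) = frag_eval (\<lambda>g. \<chi> (f g)) \<alpha>"
  by (simp add: group_ring_map_def frag_eval_frag_extend)

context group_hom
begin

lemma group_ring_map_hom: "group_ring_map h \<in> ring_hom (integral_group_ring G) (integral_group_ring H)"
proof (rule ring_hom_memI)
  fix \<alpha> \<beta> assume "\<alpha> \<in> carrier (integral_group_ring G)" "\<beta> \<in> carrier (integral_group_ring G)"
  then have keys: "Poly_Mapping.keys \<alpha> \<subseteq> carrier G" "Poly_Mapping.keys \<beta> \<subseteq> carrier G"
    by (simp_all add: integral_group_ring_def)
  show "group_ring_map h \<alpha> \<in> carrier (integral_group_ring H)"
    using keys(1) hom_closed unfolding group_ring_map_def integral_group_ring_def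
    by (fastforce dest!: keys_frag_extend[THEN subsetD] simp: keys_frag_of)
  show "group_ring_map h (\<alpha> \<otimes>\<^bsub>integral_group_ring G\<^esub> \<beta>)
      = group_ring_map h \<alpha> \<otimes>\<^bsub>integral_group_ring H\<^esub> group_ring_map h \<beta>"
    using keys
    by (auto simp: group_ring_map_def integral_group_ring_def frag_extend_frag_extend subset_iff
        intro!: frag_extend_cong)
  show "group_ring_map h (\<alpha> \<oplus>\<^bsub>integral_group_ring G\<^esub> \<beta>)
      = group_ring_map h \<alpha> \<oplus>\<^bsub>integral_group_ring H\<^esub> group_ring_map h \<beta>"
    by (simp add: group_ring_map_def integral_group_ring_def frag_extend_add)
qed (simp add: group_ring_map_def integral_group_ring_def)

lemma group_ring_map_normalized_unit:
  assumes "\<alpha> \<in> carrier (normalized_unit_group G)"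
  shows "group_ring_map h \<alpha> \<in> carrier (normalized_unit_group H)"
proof -
  let ?R = "integral_group_ring G" and ?S = "integral_group_ring H" and ?\<phi> = "group_ring_map h"
  have "\<alpha> \<in> Units ?R" "augmentation \<alpha> = 1"
    using assms by (auto simp: normalized_unit_group_def)
  then obtain \<beta> where \<beta>: "\<alpha> \<in> carrier ?R" "\<beta> \<in> carrier ?R" "\<beta> \<otimes>\<^bsub>?R\<^esub> \<alpha> = \<one>\<^bsub>?R\<^esub>" "\<alpha> \<otimes>\<^bsub>?R\<^esub> \<beta> = \<one>\<^bsub>?R\<^esub>"
    by (auto simp: Units_def)
  have "?\<phi> \<beta> \<otimes>\<^bsub>?S\<^esub> ?\<phi> \<alpha> = \<one>\<^bsub>?S\<^esub>" "?\<phi> \<alpha> \<otimes>\<^bsub>?S\<^esub> ?\<phi> \<beta> = \<one>\<^bsub>?S\<^esub>"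
    using \<beta> ring_hom_mult[OF group_ring_map_hom] ring_hom_one[OF group_ring_map_hom] by metis+
  then have "?\<phi> \<alpha> \<in> Units ?S"
    using \<beta>(1,2) ring_hom_closed[OF group_ring_map_hom] unfolding Units_def by blast
  moreover have "augmentation (?\<phi> \<alpha>) = 1"
    using \<open>augmentation \<alpha> = 1\<close> by (simp add: augmentation_frag_eval frag_eval_group_ring_map)
  ultimately show ?thesis by (simp add: normalized_unit_group_def)
qed

lemma group_ring_map_pow:
  fixes n :: nat
  assumes "\<alpha> \<in> carrier (integral_group_ring G)"
  shows "group_ring_map h (\<alpha> [^]\<^bsub>integral_group_ring G\<^esub> n)
    = group_ring_map h \<alpha> [^]\<^bsub>integral_group_ring H\<^esub> n"
proof -
  interpret R: ring "integral_group_ring G" by (rule ring_integral_group_ring[OF G.is_group])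
  show ?thesis
  proof (induction n)
    case 0
    then show ?case using ring_hom_one[OF group_ring_map_hom] by (simp add: nat_pow_def)
  next
    case (Suc n)
    have "group_ring_map h (\<alpha> [^]\<^bsub>integral_group_ring G\<^esub> Suc n)
      = group_ring_map h (\<alpha> [^]\<^bsub>integral_group_ring G\<^esub> n) \<otimes>\<^bsub>integral_group_ring H\<^esub> group_ring_map h \<alpha>"
      using ring_hom_mult[OF group_ring_map_hom R.nat_pow_closed[OF assms] assms] by (simp add: nat_pow_def)
    then show ?case using Suc by (simp add: nat_pow_def)
  qed
qed

end

lemma normalized_unit_group_pow:
  fixes n :: nat
  shows "\<alpha> [^]\<^bsub>normalized_unit_group G\<^esub> n = \<alpha> [^]\<^bsub>integral_group_ring G\<^esub> n"
  by (simp add: nat_pow_def normalized_unit_group_def units_of_def)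

lemma normalized_unit_group_one: "\<one>\<^bsub>normalized_unit_group G\<^esub> = \<one>\<^bsub>integral_group_ring G\<^esub>"
  by (simp add: normalized_unit_group_def units_of_def)

text \<open>Choose a finite quotient that keeps apart the classes on which \<alpha> has nonzero
  trace. Those traces survive unchanged, so uniqueness in the quotient pulls back to
  \<open>G\<close>.\<close>

lemma (in group) UT_group_of_finite_quotients:
  assumes noeth: "noetherian_group G" and solv: "solvable G"
    and UT: "\<And>N. N \<lhd> G \<Longrightarrow> finite (carrier (G Mod N)) \<Longrightarrow> UT_group (G Mod N)"
  shows "UT_group G"
proof -
  show ?thesis
    unfolding UT_group_def
  proof (intro ballI impI)
    fix \<alpha> assume unit: "\<alpha> \<in> carrier (normalized_unit_group G)"
    assume "\<exists>n::nat. n > 0 \<and> \<alpha> [^]\<^bsub>normalized_unit_group G\<^esub> n = \<one>\<^bsub>normalized_unit_group G\<^esub>"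
    then obtain n :: nat where n: "n > 0" "\<alpha> [^]\<^bsub>integral_group_ring G\<^esub> n = \<one>\<^bsub>integral_group_ring G\<^esub>"
      by (auto simp: normalized_unit_group_pow normalized_unit_group_one)
    have \<alpha>: "\<alpha> \<in> carrier (integral_group_ring G)" and aug: "augmentation \<alpha> = 1"
      using unit by (auto simp: normalized_unit_group_def Units_def)
    then have keys: "Poly_Mapping.keys \<alpha> \<subseteq> carrier G" by (simp add: integral_group_ring_def)
    \<comment> \<open>A finite set meeting every conjugacy class with nonzero trace, possibly
      several times.\<close>
    define R where "R = {g \<in> Poly_Mapping.keys \<alpha>. partial_trace G \<alpha> g \<noteq> 0}"
    have "finite R" "R \<subseteq> carrier G" using keys by (auto simp: R_def)
    have "\<exists>k::nat. k > 0 \<and> g [^] k = \<one>" if "g \<in> R" for g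
      using torsion_of_partial_trace_nonzero[OF noeth keys _ n(2,1)] that keys by (auto simp: R_def)
    then obtain e where e: "\<And>g. g \<in> R \<Longrightarrow> e g > (0::nat) \<and> g [^] e g = \<one>" by metis
    \<comment> \<open>A common exponent for the torsion elements in \<open>R\<close>.\<close>
    define m where "m = prod e R"
    have m: "m > 0" unfolding m_def using e by (intro prod_pos) auto
    have R_pow: "g [^] m = \<one>" if "g \<in> R" for g
    proof -
      have "e g dvd m" unfolding m_def using that \<open>finite R\<close> by (rule dvd_prodI[rotated])
      then obtain l where "m = e g * l" by blast
      moreover have "(g [^] e g) [^] l = \<one>" using e[OF that] by simp
      ultimately show ?thesis using \<open>R \<subseteq> carrier G\<close> that by (simp add: nat_pow_pow subset_iff)
    qed
    obtain N where N: "N \<lhd> G" "finite (carrier (G Mod N))" and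
      sep: "\<And>x y k. x \<in> carrier G \<Longrightarrow> y \<in> carrier G \<Longrightarrow> k \<in> carrier G \<Longrightarrow> x [^] m = \<one> \<Longrightarrow> y [^] m = \<one> \<Longrightarrow>
        k \<otimes> x \<otimes> inv k \<otimes> inv y \<in> N \<Longrightarrow> \<exists>k'\<in>carrier G. k' \<otimes> x \<otimes> inv k' = y"
      by (rule torsion_conjugacy_separable[OF noeth solv m]) blast
    interpret N: normal N G by fact
    let ?Q = "G Mod N" and ?\<pi> = "\<lambda>a. N #> a"
    interpret \<pi>: group_hom G ?Q ?\<pi> by (rule N.quotient_hom)
    have conj_of_image: "y \<in> conjugacy_class G x"
      if xy: "x \<in> R" "y \<in> R" "?\<pi> y \<in> conjugacy_class ?Q (?\<pi> x)" for x y
    proof -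
      have c: "x \<in> carrier G" "y \<in> carrier G" using xy \<open>R \<subseteq> carrier G\<close> by auto
      obtain K where K: "K \<in> carrier ?Q" "K \<otimes>\<^bsub>?Q\<^esub> ?\<pi> x \<otimes>\<^bsub>?Q\<^esub> inv\<^bsub>?Q\<^esub> K = ?\<pi> y"
        using xy(3) unfolding \<pi>.H.conjugacy_class_iff by blast
      obtain k where k: "k \<in> carrier G" "K = ?\<pi> k" using K(1) N.quotient_surj by blast
      have "?\<pi> (k \<otimes> x \<otimes> inv k) = ?\<pi> y"
        using K(2) k c by (simp only: \<pi>.hom_mult \<pi>.hom_inv m_closed inv_closed)
      moreover have "k \<otimes> x \<otimes> inv k \<in> carrier G" using k(1) c(1) by simp
      ultimately have "k \<otimes> x \<otimes> inv k \<otimes> inv y \<in> N" using N.quotient_eq_iff c(2) by blast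
      then show ?thesis
        using sep[OF c k(1) R_pow[OF xy(1)] R_pow[OF xy(2)]] unfolding conjugacy_class_iff by blast
    qed
    let ?\<alpha>Q = "group_ring_map ?\<pi> \<alpha>"
    have trace_Q: "partial_trace ?Q ?\<alpha>Q (?\<pi> x) = partial_trace G \<alpha> x" if x: "x \<in> R" for x
    proof -
      let ?T = "{h \<in> carrier G. ?\<pi> h \<in> conjugacy_class ?Q (?\<pi> x)}"
      let ?C = "conjugacy_class G x"
      have xG: "x \<in> carrier G" using x \<open>R \<subseteq> carrier G\<close> by blast
      have image_conj: "?\<pi> y \<in> conjugacy_class ?Q (?\<pi> h)" if yh: "y \<in> conjugacy_class G h" "h \<in> carrier G" for y h
      proof -
        obtain k where k: "k \<in> carrier G" "k \<otimes> h \<otimes> inv k = y" using yh(1) unfolding conjugacy_class_iff by blast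
        have "?\<pi> k \<otimes>\<^bsub>?Q\<^esub> ?\<pi> h \<otimes>\<^bsub>?Q\<^esub> inv\<^bsub>?Q\<^esub> ?\<pi> k = ?\<pi> (k \<otimes> h \<otimes> inv k)"
          using k(1) yh(2) by (simp only: \<pi>.hom_mult \<pi>.hom_inv m_closed inv_closed)
        then show ?thesis using k \<pi>.hom_closed unfolding \<pi>.H.conjugacy_class_iff by blast
      qed
      have "partial_trace ?Q ?\<alpha>Q (?\<pi> x) = (\<Sum>h\<in>?T \<inter> Poly_Mapping.keys \<alpha>. Poly_Mapping.lookup \<alpha> h)"
      proof -
        have "?T \<inter> Poly_Mapping.keys \<alpha> = {h. ?\<pi> h \<in> conjugacy_class ?Q (?\<pi> x)} \<inter> Poly_Mapping.keys \<alpha>"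
          using keys by blast
        then show ?thesis
          using frag_eval_of_bool[of "{h. ?\<pi> h \<in> conjugacy_class ?Q (?\<pi> x)}" \<alpha>]
          by (simp add: partial_trace_frag_eval[of ?Q] frag_eval_group_ring_map)
      qed
      \<comment> \<open>The preimage \<open>?T\<close> of the class in the quotient is a union of
        classes of \<open>G\<close>. Besides \<open>?C\<close> it contains only classes of trace
        zero, because the quotient separates the classes of elements of \<open>R\<close>.\<close>
      also have "\<dots> = (\<Sum>h\<in>(?T - ?C) \<inter> Poly_Mapping.keys \<alpha>. Poly_Mapping.lookup \<alpha> h) + partial_trace G \<alpha> x"
      proof -
        have "?C \<subseteq> ?T" using image_conj xG conjugacy_class_closed by blast
        then have eq: "?T \<inter> Poly_Mapping.keys \<alpha> = ((?T - ?C) \<inter> Poly_Mapping.keys \<alpha>) \<union> (?C \<inter> Poly_Mapping.keys \<alpha>)"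
          by blast
        show ?thesis
          unfolding partial_trace_def by (subst eq, rule sum.union_disjoint) auto
      qed
      also have "(\<Sum>h\<in>(?T - ?C) \<inter> Poly_Mapping.keys \<alpha>. Poly_Mapping.lookup \<alpha> h) = 0"
      proof -
        have "0 dvd (\<Sum>h\<in>(?T - ?C) \<inter> Poly_Mapping.keys \<alpha>. Poly_Mapping.lookup \<alpha> h)"
        proof (rule dvd_sum_partial_traces[OF keys])
          fix h y assume h: "h \<in> (?T - ?C) \<inter> Poly_Mapping.keys \<alpha>" and y: "y \<in> conjugacy_class G h"
          have hG: "h \<in> carrier G" using h by blast
          have "y \<notin> ?C"
            using conjugacy_class_trans[OF xG _ conjugacy_class_sym[OF hG y]] h by blast
          moreover have "?\<pi> y \<in> conjugacy_class ?Q (?\<pi> x)"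
            using \<pi>.H.conjugacy_class_trans[OF \<pi>.hom_closed[OF xG] _ image_conj[OF y hG]] h by blast
          ultimately show "y \<in> ?T - ?C" using conjugacy_class_closed[OF hG y] by blast
        next
          fix h assume h: "h \<in> (?T - ?C) \<inter> Poly_Mapping.keys \<alpha>"
          then have "h \<notin> R" using conj_of_image[OF x] by blast
          then show "0 dvd partial_trace G \<alpha> h" using h by (simp add: R_def)
        qed
        then show ?thesis by simp
      qed
      finally show ?thesis by simp
    qed
    have repr: "\<exists>x\<in>R. x \<in> conjugacy_class G g" if g: "g \<in> carrier G" "partial_trace G \<alpha> g \<noteq> 0" for g
    proof -
      have "conjugacy_class G g \<inter> Poly_Mapping.keys \<alpha> \<noteq> {}"
      proof
        assume "conjugacy_class G g \<inter> Poly_Mapping.keys \<alpha> = {}"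
        then have "partial_trace G \<alpha> g = 0" by (simp add: partial_trace_def)
        then show False using g(2) by simp
      qed
      then obtain x where x: "x \<in> conjugacy_class G g" "x \<in> Poly_Mapping.keys \<alpha>" by blast
      have "partial_trace G \<alpha> x = partial_trace G \<alpha> g"
        unfolding partial_trace_def conjugacy_class_eq[OF g(1) x(1)] ..
      then show ?thesis using x g(2) unfolding R_def by auto
    qed
    \<comment> \<open>If all traces vanished, their sum, the augmentation, would be \<open>0\<close>
      instead of \<open>1\<close>.\<close>
    have "R \<noteq> {}"
    proof
      assume "R = {}"
      then have "0 dvd (\<Sum>h\<in>carrier G \<inter> Poly_Mapping.keys \<alpha>. Poly_Mapping.lookup \<alpha> h)"
        using conjugacy_class_closed by (intro dvd_sum_partial_traces[OF keys]) (auto simp: R_def)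
      then show False using aug keys by (simp add: augmentation_def Int_absorb1)
    qed
    then obtain x where x: "x \<in> R" by blast
    have "unique_trace ?Q ?\<alpha>Q"
    proof -
      have "?\<alpha>Q [^]\<^bsub>integral_group_ring ?Q\<^esub> n = \<one>\<^bsub>integral_group_ring ?Q\<^esub>"
        using \<pi>.group_ring_map_pow[OF \<alpha>, of n] n(2) ring_hom_one[OF \<pi>.group_ring_map_hom] by simp
      then show ?thesis
        using UT[OF N] \<pi>.group_ring_map_normalized_unit[OF unit] n(1)
        unfolding UT_group_def normalized_unit_group_pow normalized_unit_group_one by blast
    qed
    then obtain g0 where g0: "g0 \<in> carrier ?Q"
      "\<And>h. h \<in> carrier ?Q \<Longrightarrow> partial_trace ?Q ?\<alpha>Q h \<noteq> 0 \<Longrightarrow> h \<in> conjugacy_class ?Q g0"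
      unfolding unique_trace_def by blast
    have R_Q: "?\<pi> y \<in> conjugacy_class ?Q g0" if y: "y \<in> R" for y
      using g0(2)[of "?\<pi> y"] trace_Q[OF y] y \<open>R \<subseteq> carrier G\<close> \<pi>.hom_closed by (auto simp: R_def)
    \<comment> \<open>The images of \<open>x\<close> and \<open>y\<close> both lie in the class of
      \<open>g0\<close>, hence are conjugate in the quotient, and conjugacy lifts by
      \<open>conj_of_image\<close>.\<close>
    have R_conj: "y \<in> conjugacy_class G x" if y: "y \<in> R" for y
      using conj_of_image[OF x y] R_Q[OF y] \<pi>.H.conjugacy_class_eq[OF g0(1) R_Q[OF x]] by blast
    show "unique_trace G \<alpha>"
      unfolding unique_trace_def
    proof (intro bexI[of _ x] conjI ballI impI)
      show "x \<in> carrier G" "partial_trace G \<alpha> x \<noteq> 0" using x \<open>R \<subseteq> carrier G\<close> by (auto simp: R_def)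
      fix h assume h: "h \<in> carrier G" "partial_trace G \<alpha> h \<noteq> 0"
      then obtain y where y: "y \<in> R" "y \<in> conjugacy_class G h" using repr by blast
      show "h \<in> conjugacy_class G x"
        using conjugacy_class_trans[OF _ R_conj[OF y(1)] conjugacy_class_sym[OF h(1) y(2)]] x \<open>R \<subseteq> carrier G\<close> by blast
    qed
  qed
qed

theorem theorem3p11:
  fixes G :: "('a, 'b) monoid_scheme"
  assumes "group G"
    and "polycyclic G"
    and "\<And>N. N \<lhd> G \<Longrightarrow> finite (carrier (G Mod N)) \<Longrightarrow> UT_group (G Mod N)"
  shows "UT_group G"
  using group.UT_group_of_finite_quotients[OF assms(1) _ _ assms(3)]
    group.polycyclic_imp_noetherian[OF assms(1,2)] group.polycyclic_imp_solvable[OF assms(1,2)]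
  by blast

end
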